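(* Let $(A,\mu_A,\alpha_A,\beta_A)$ and $(B,\mu_B,\alpha_B,\beta_B)$ be two BiHom-associative algebras with bijective structure maps and $R:B\otimes A\to A\otimes B$ a BiHom-twisting map, with notation $R(b\otimes a)=a_R\otimes b_R$. Put $D=A\otimes B$ and define the linear map $$T:D\otimes D\to D\otimes D,\qquad T((a\otimes b)\otimes(a'\otimes b'))=(a\otimes b_R)\otimes(a'_R\otimes b').$$ Then $T$ is a BiHom-pseudotwistor for the tensor product BiHom-associative algebra $(A\otimes B,\mu_{A\otimes B},\alpha_A\otimes\alpha_B,\beta_A\otimes\beta_B)$, with companions $\tilde T_1,\tilde T_2:D\otimes D\otimes D\to D\otimes D\otimes D$ given by \begin{gather*} \tilde T_1=(\mathrm{id}_A\otimes\alpha_B^{-1}\beta_B\otimes\mathrm{id}_A\otimes\mathrm{id}_B\otimes\mathrm{id}_A\otimes\mathrm{id}_B)\circ T_{13}\circ(\mathrm{id}_A\otimes\alpha_B\beta_B^{-1}\otimes\mathrm{id}_A\otimes\mathrm{id}_B\otimes\mathrm{id}_A\otimes\mathrm{id}_B),\\ \tilde T_2=(\mathrm{id}_A\otimes\mathrm{id}_B\otimes\mathrm{id}_A\otimes\mathrm{id}_B\otimes\alpha_A\beta_A^{-1}\otimes\mathrm{id}_B)\circ T_{13}\circ(\mathrm{id}_A\otimes\mathrm{id}_B\otimes\mathrm{id}_A\otimes\mathrm{id}_B\otimes\alpha_A^{-1}\beta_A\otimes\mathrm{id}_B). \end{gather*} The resulting BiHom-associative algebra $(A\otimes B)^T$,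 denoted $A\otimes_RB$, has multiplication $(a\otimes b)(a'\otimes b')=aa'_R\otimes b_Rb'$ and structure maps $\alpha_A\otimes\alpha_B$ and $\beta_A\otimes\beta_B$.
   Context: All vector spaces are over a field $\Bbbk$; algebras are not assumed unital. A BiHom-associative algebra $(A,\mu,\alpha,\beta)$: $\mu:A\otimes A\to A$ (written by juxtaposition), $\alpha,\beta:A\to A$ (the structure maps) linear with $\alpha\beta=\beta\alpha$, $\alpha(aa')=\alpha(a)\alpha(a')$, $\beta(aa')=\beta(a)\beta(a')$, $\alpha(a)(a'a'')=(aa')\beta(a'')$. The tensor product of two BiHom-associative algebras is $A\otimes B$ with $\mu_{A\otimes B}((a\otimes b)\otimes(a'\otimes b'))=aa'\otimes bb'$ and structure maps $\alpha_A\otimes\alpha_B$, $\beta_A\otimes\beta_B$. For BiHom-associative algebras $A,B$ with bijective structure maps, a BiHom-twisting map between $A$ and $B$ is a linear map $R:B\otimes A\to A\otimes B$ with $(\alpha_A\otimes\alpha_B)R=R(\alpha_B\otimes\alpha_A)$, $(\beta_A\otimes\beta_B)R=R(\beta_B\otimes\beta_A)$, $R\circ(\alpha_B\otimes\mu_A)=(\mu_A\otimes\beta_B)\circ(\mathrm{id}_A\otimes R)\circ(\mathrm{id}_A\otimes\alpha_B\beta_B^{-1}\otimes\mathrm{id}_A)\circ(R\otimes\mathrm{id}_A)$, $R\circ(\mu_B\otimes\beta_A)=(\alpha_A\otimes\mu_B)\circ(R\otimes\mathrm{id}_B)\circ(\mathrm{id}_B\otimes\alpha_A^{-1}\beta_A\otimes\mathrm{id}_B)\circ(\mathrm{id}_B\otimes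 R)$. A BiHom-pseudotwistor for a BiHom-associative algebra $(D,\mu,\tilde\alpha,\tilde\beta)$, with companions $\tilde T_1,\tilde T_2:D^{\otimes3}\to D^{\otimes3}$ (linear), is a linear map $T:D\otimes D\to D\otimes D$ such that $(\tilde\alpha\otimes\tilde\alpha)T=T(\tilde\alpha\otimes\tilde\alpha)$, $(\tilde\beta\otimes\tilde\beta)T=T(\tilde\beta\otimes\tilde\beta)$, $T(\tilde\alpha\otimes\mu)=(\tilde\alpha\otimes\mu)\tilde T_1(T\otimes\mathrm{id}_D)$, $T(\mu\otimes\tilde\beta)=(\mu\otimes\tilde\beta)\tilde T_2(\mathrm{id}_D\otimes T)$, $\tilde T_1(T\otimes\mathrm{id}_D)(\mathrm{id}_D\otimes T)=\tilde T_2(\mathrm{id}_D\otimes T)(T\otimes\mathrm{id}_D)$. In this case $D^T:=(D,\mu\circ T,\tilde\alpha,\tilde\beta)$ is a BiHom-associative algebra. $T_{13}:D^{\otimes3}\to D^{\otimes3}$ denotes $T$ acting on the first and third tensor factors $D=A\otimes B$ and as the identity on the second. *)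

theory Defs
  imports "HOL-Algebra.AbelCoset" "Jordan_Normal_Form.Missing_VectorSpace"
begin

section \<open>Tensor products of vector spaces\<close>

definition free_vs :: "('k, 'm) ring_scheme \<Rightarrow> 's set \<Rightarrow> ('k, 's \<Rightarrow> 'k) module" where
  "free_vs K S =
    \<lparr>carrier = {f. (\<forall>s. f s \<in> carrier K) \<and> {s. f s \<noteq> \<zero>\<^bsub>K\<^esub>} \<subseteq> S \<and> finite {s. f s \<noteq> \<zero>\<^bsub>K\<^esub>}},
     mult = (\<lambda>f g s. \<zero>\<^bsub>K\<^esub>), one = (\<lambda>s. \<zero>\<^bsub>K\<^esub>),
     zero = (\<lambda>s. \<zero>\<^bsub>K\<^esub>), add = (\<lambda>f g s. f s \<oplus>\<^bsub>K\<^esub> g s),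
     smult = (\<lambda>c f s. c \<otimes>\<^bsub>K\<^esub> f s)\<rparr>"

definition free_gen :: "('k, 'm) ring_scheme \<Rightarrow> 's \<Rightarrow> 's \<Rightarrow> 'k" where
  "free_gen K s = (\<lambda>t. if t = s then \<one>\<^bsub>K\<^esub> else \<zero>\<^bsub>K\<^esub>)"

definition quotient_vs :: "('k, 'a, 'm) module_scheme \<Rightarrow> 'a set \<Rightarrow> ('k, 'a set) module" where
  "quotient_vs V N =
    \<lparr>carrier = a_rcosets\<^bsub>V\<^esub> N,
     mult = (\<lambda>X Y. N), one = N,
     zero = N, add = (\<lambda>X Y. X <+>\<^bsub>V\<^esub> Y),
     smult = (\<lambda>c X. \<Union>x\<in>X. N +>\<^bsub>V\<^esub> (c \<odot>\<^bsub>V\<^esub> x))\<rparr>"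

text \<open>The fields \<open>mult\<close> and \<open>one\<close>, which a \<open>module\<close> record inherits from rings, carry no
  information about the vector space and are filled arbitrarily in both constructions.\<close>

abbreviation pair_vs ::
  "('k, 'm) ring_scheme \<Rightarrow> ('k, 'a, 'm1) module_scheme \<Rightarrow> ('k, 'b, 'm2) module_scheme \<Rightarrow>
   ('k, 'a \<times> 'b \<Rightarrow> 'k) module" where
  "pair_vs K V W \<equiv> free_vs K (carrier V \<times> carrier W)"

definition tensor_rels ::
  "('k, 'm) ring_scheme \<Rightarrow> ('k, 'a, 'm1) module_scheme \<Rightarrow> ('k, 'b, 'm2) module_scheme \<Rightarrow>
   ('a \<times> 'b \<Rightarrow> 'k) set" where
  "tensor_rels K V W =
    (let F = pair_vs K V W; g = (\<lambda>v w. free_gen K (v, w)) in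
      {g (v \<oplus>\<^bsub>V\<^esub> v') w \<ominus>\<^bsub>F\<^esub> (g v w \<oplus>\<^bsub>F\<^esub> g v' w) | v v' w.
          v \<in> carrier V \<and> v' \<in> carrier V \<and> w \<in> carrier W} \<union>
      {g v (w \<oplus>\<^bsub>W\<^esub> w') \<ominus>\<^bsub>F\<^esub> (g v w \<oplus>\<^bsub>F\<^esub> g v w') | v w w'.
          v \<in> carrier V \<and> w \<in> carrier W \<and> w' \<in> carrier W} \<union>
      {g (c \<odot>\<^bsub>V\<^esub> v) w \<ominus>\<^bsub>F\<^esub> c \<odot>\<^bsub>F\<^esub> g v w | c v w.
          c \<in> carrier K \<and> v \<in> carrier V \<and> w \<in> carrier W} \<union>
      {g v (c \<odot>\<^bsub>W\<^esub> w) \<ominus>\<^bsub>F\<^esub> c \<odot>\<^bsub>F\<^esub> g v w | c v w.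
          c \<in> carrier K \<and> v \<in> carrier V \<and> w \<in> carrier W})"

definition tensor_null ::
  "('k, 'm) ring_scheme \<Rightarrow> ('k, 'a, 'm1) module_scheme \<Rightarrow> ('k, 'b, 'm2) module_scheme \<Rightarrow>
   ('a \<times> 'b \<Rightarrow> 'k) set" where
  "tensor_null K V W = LinearCombinations.module.span K (pair_vs K V W) (tensor_rels K V W)"

definition tensor ::
  "('k, 'm) ring_scheme \<Rightarrow> ('k, 'a, 'm1) module_scheme \<Rightarrow> ('k, 'b, 'm2) module_scheme \<Rightarrow>
   ('k, ('a \<times> 'b \<Rightarrow> 'k) set) module"  (infixl \<open>\<boxtimes>\<index>\<close> 70) where
  "V \<boxtimes>\<^bsub>K\<^esub> W = quotient_vs (pair_vs K V W) (tensor_null K V W)"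

text \<open>The pure tensor of \<open>v\<close> and \<open>w\<close> in the tensor product of \<open>V\<close> and \<open>W\<close>.\<close>

definition pt ::
  "('k, 'm) ring_scheme \<Rightarrow> ('k, 'a, 'm1) module_scheme \<Rightarrow> ('k, 'b, 'm2) module_scheme \<Rightarrow>
   'a \<Rightarrow> 'b \<Rightarrow> ('a \<times> 'b \<Rightarrow> 'k) set" where
  "pt K V W v w = tensor_null K V W +>\<^bsub>pair_vs K V W\<^esub> free_gen K (v, w)"

text \<open>For bilinear \<open>f\<close>, the linear map into \<open>Z\<close> that sends the pure tensor of \<open>v\<close> and \<open>w\<close> to
  \<open>f v w\<close>: the formal combination \<open>\<phi>\<close> is evaluated through \<open>f\<close>, and bilinearity makes the
  value independent of the representative \<open>\<phi>\<close> of the coset \<open>X\<close>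
  (see \<open>tensor_lift_pt\<close> and \<open>tensor_lift_hom\<close> below).\<close>

definition tensor_lift ::
  "('k, 'm) ring_scheme \<Rightarrow> ('k, 'z, 'm1) module_scheme \<Rightarrow> ('a \<Rightarrow> 'b \<Rightarrow> 'z) \<Rightarrow>
   ('a \<times> 'b \<Rightarrow> 'k) set \<Rightarrow> 'z" where
  "tensor_lift K Z f X =
    the_elem ((\<lambda>\<phi>. \<Oplus>\<^bsub>Z\<^esub>p\<in>{p. \<phi> p \<noteq> \<zero>\<^bsub>K\<^esub>}. \<phi> p \<odot>\<^bsub>Z\<^esub> f (fst p) (snd p)) ` X)"

text \<open>\<open>tensor_map K V' W' f g\<close> is the tensor product of linear maps \<open>f\<close> into \<open>V'\<close> and
  \<open>g\<close> into \<open>W'\<close>.\<close>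

definition tensor_map ::
  "('k, 'm) ring_scheme \<Rightarrow> ('k, 'c, 'm1) module_scheme \<Rightarrow> ('k, 'd, 'm2) module_scheme \<Rightarrow>
   ('a \<Rightarrow> 'c) \<Rightarrow> ('b \<Rightarrow> 'd) \<Rightarrow> ('a \<times> 'b \<Rightarrow> 'k) set \<Rightarrow> ('c \<times> 'd \<Rightarrow> 'k) set" where
  "tensor_map K V' W' f g = tensor_lift K (V' \<boxtimes>\<^bsub>K\<^esub> W') (\<lambda>v w. pt K V' W' (f v) (g w))"

text \<open>The linear maps into \<open>Z\<close> given on \<open>(u \<otimes> v) \<otimes> w\<close> and on \<open>(u \<otimes> v) \<otimes> (w \<otimes> x)\<close> by a
  multilinear \<open>f\<close>.\<close>

definition tensor_lift3 where
  "tensor_lift3 K Z f = tensor_lift K Z (\<lambda>x w. tensor_lift K Z (\<lambda>u v. f u v w) x)"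

definition tensor_lift4 where
  "tensor_lift4 K Z f =
    tensor_lift K Z (\<lambda>x y. tensor_lift K Z (\<lambda>u v. tensor_lift K Z (\<lambda>w z. f u v w z) y) x)"

text \<open>Threefold tensor products are bracketed to the left; identifications with the other
  bracketing are made explicit by the associator \<open>(u \<otimes> v) \<otimes> w \<mapsto> u \<otimes> (v \<otimes> w)\<close> and its inverse.\<close>

definition tassoc where
  "tassoc K U V W =
    tensor_lift3 K (U \<boxtimes>\<^bsub>K\<^esub> (V \<boxtimes>\<^bsub>K\<^esub> W)) (\<lambda>u v w. pt K U (V \<boxtimes>\<^bsub>K\<^esub> W) u (pt K V W v w))"

definition tassoc_inv where
  "tassoc_inv K U V W =
    tensor_lift K ((U \<boxtimes>\<^bsub>K\<^esub> V) \<boxtimes>\<^bsub>K\<^esub> W)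
      (\<lambda>u. tensor_lift K ((U \<boxtimes>\<^bsub>K\<^esub> V) \<boxtimes>\<^bsub>K\<^esub> W) (\<lambda>v w. pt K (U \<boxtimes>\<^bsub>K\<^esub> V) W (pt K U V u v) w))"

subsection \<open>Universal property\<close>

lemma free_vs_simps:
  "zero (free_vs K S) = (\<lambda>s. \<zero>\<^bsub>K\<^esub>)"
  "add (free_vs K S) = (\<lambda>f g s. f s \<oplus>\<^bsub>K\<^esub> g s)"
  "smult (free_vs K S) = (\<lambda>c f s. c \<otimes>\<^bsub>K\<^esub> f s)"
  by (simp_all add: free_vs_def)

lemma free_vs_carrier: "f \<in> carrier (free_vs K S) \<longleftrightarrow>
   (\<forall>s. f s \<in> carrier K) \<and> {s. f s \<noteq> \<zero>\<^bsub>K\<^esub>} \<subseteq> S \<and> finite {s. f s \<noteq> \<zero>\<^bsub>K\<^esub>}"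
  by (simp add: free_vs_def)

lemma free_vs_vectorspace:
  fixes K (structure)
  assumes "field K" shows "vectorspace K (free_vs K S)"
proof -
  interpret field K by fact
  have add: "f \<oplus>\<^bsub>free_vs K S\<^esub> g \<in> carrier (free_vs K S)"
    if "f \<in> carrier (free_vs K S)" "g \<in> carrier (free_vs K S)" for f g
  proof -
    have "{s. f s \<oplus> g s \<noteq> \<zero>} \<subseteq> {s. f s \<noteq> \<zero>} \<union> {s. g s \<noteq> \<zero>}" by auto
    then show ?thesis using that
      by (auto simp: free_vs_carrier free_vs_simps intro: finite_subset)
  qed
  have smult: "c \<odot>\<^bsub>free_vs K S\<^esub> f \<in> carrier (free_vs K S)"
    if "c \<in> carrier K" "f \<in> carrier (free_vs K S)" for c f
  proof -
    have "{s. c \<otimes> f s \<noteq> \<zero>} \<subseteq> {s. f s \<noteq> \<zero>}" using that by auto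
    then show ?thesis using that
      by (auto simp: free_vs_carrier free_vs_simps intro: finite_subset)
  qed
  have ab: "abelian_group (free_vs K S)"
  proof (rule abelian_groupI)
    fix x assume x: "x \<in> carrier (free_vs K S)"
    have "\<And>s. \<ominus> x s \<noteq> \<zero> \<longleftrightarrow> x s \<noteq> \<zero>" using x
      by (metis add.inv_closed free_vs_carrier minus_minus minus_zero)
    then have "(\<lambda>s. \<ominus> x s) \<in> carrier (free_vs K S)"
      using x by (auto simp: free_vs_carrier)
    moreover have "(\<lambda>s. \<ominus> x s) \<oplus>\<^bsub>free_vs K S\<^esub> x = \<zero>\<^bsub>free_vs K S\<^esub>"
      using x by (auto simp: free_vs_carrier free_vs_simps l_neg)
    ultimately show "\<exists>y\<in>carrier (free_vs K S). y \<oplus>\<^bsub>free_vs K S\<^esub> x = \<zero>\<^bsub>free_vs K S\<^esub>" by blast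
  qed (use add in \<open>auto simp: free_vs_carrier free_vs_simps a_ac\<close>)
  have "module K (free_vs K S)"
    by (rule moduleI[OF is_cring ab smult])
      (auto simp: free_vs_carrier free_vs_simps l_distr r_distr m_assoc)
  then show ?thesis by (rule vectorspace.intro) (rule field_axioms)
qed

lemma quotient_vectorspace:
  assumes "vectorspace K V" and N: "Module.submodule N K V"
  shows "vectorspace K (quotient_vs V N)"
    and "(\<lambda>v. N +>\<^bsub>V\<^esub> v) \<in> module_hom K V (quotient_vs V N)"
    and "\<And>v w. v \<in> carrier V \<Longrightarrow> w \<in> carrier V \<Longrightarrow> v \<ominus>\<^bsub>V\<^esub> w \<in> N \<Longrightarrow> N +>\<^bsub>V\<^esub> v = N +>\<^bsub>V\<^esub> w"
proof -
  interpret V: vectorspace K V by fact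
  interpret N: additive_subgroup N V
    using N by (simp add: additive_subgroup_def Module.submodule_def)
  interpret abelian_subgroup N V
    by (rule abelian_subgroupI3) (unfold_locales)
  have sm: "c \<odot>\<^bsub>V\<^esub> n \<in> N" if "c \<in> carrier K" "n \<in> N" for c n
    using N that by (simp add: Module.submodule_def submodule_axioms_def)
  show eq: "N +>\<^bsub>V\<^esub> v = N +>\<^bsub>V\<^esub> w"
    if "v \<in> carrier V" "w \<in> carrier V" "v \<ominus>\<^bsub>V\<^esub> w \<in> N" for v w
    using that V.M.a_repr_independence'[OF _ that(2) N.a_subgroup, of v]
      a_rcos_module_rev[OF that(2,1)] by (simp add: V.M.minus_eq a_r_coset_def)
  have mem: "x \<ominus>\<^bsub>V\<^esub> v \<in> N" "x \<in> carrier V" if "v \<in> carrier V" "x \<in> N +>\<^bsub>V\<^esub> v" for x v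
    using that a_elemrcos_carrier a_rcos_module_imp by (auto simp: V.M.minus_eq)
  have smc: "(\<Union>x\<in>N +>\<^bsub>V\<^esub> v. N +>\<^bsub>V\<^esub> (c \<odot>\<^bsub>V\<^esub> x)) = N +>\<^bsub>V\<^esub> (c \<odot>\<^bsub>V\<^esub> v)"
    if "c \<in> carrier K" "v \<in> carrier V" for c v
  proof -
    have "N +>\<^bsub>V\<^esub> (c \<odot>\<^bsub>V\<^esub> x) = N +>\<^bsub>V\<^esub> (c \<odot>\<^bsub>V\<^esub> v)" if x: "x \<in> N +>\<^bsub>V\<^esub> v" for x
    proof (rule eq)
      have xc: "x \<in> carrier V" using mem x \<open>v \<in> _\<close> by auto
      have "c \<odot>\<^bsub>V\<^esub> x \<ominus>\<^bsub>V\<^esub> c \<odot>\<^bsub>V\<^esub> v = c \<odot>\<^bsub>V\<^esub> (x \<ominus>\<^bsub>V\<^esub> v)"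
        using \<open>c \<in> _\<close> \<open>v \<in> _\<close> xc by (simp add: V.M.minus_eq V.smult_r_distr V.smult_r_minus)
      then show "c \<odot>\<^bsub>V\<^esub> x \<ominus>\<^bsub>V\<^esub> c \<odot>\<^bsub>V\<^esub> v \<in> N" using sm mem x \<open>c \<in> _\<close> \<open>v \<in> _\<close> by auto
    qed (use \<open>c \<in> _\<close> \<open>v \<in> _\<close> x mem in auto)
    moreover have "v \<in> N +>\<^bsub>V\<^esub> v" using that a_rcos_self by auto
    ultimately show ?thesis by blast
  qed
  have [simp]: "carrier (quotient_vs V N) = (\<lambda>v. N +>\<^bsub>V\<^esub> v) ` carrier V"
    by (auto simp: quotient_vs_def A_RCOSETS_def')
  have z: "zero (quotient_vs V N) = N +>\<^bsub>V\<^esub> \<zero>\<^bsub>V\<^esub>"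
    by (simp add: quotient_vs_def N.a_subset)
  have ad: "(N +>\<^bsub>V\<^esub> v) \<oplus>\<^bsub>quotient_vs V N\<^esub> (N +>\<^bsub>V\<^esub> w) = N +>\<^bsub>V\<^esub> (v \<oplus>\<^bsub>V\<^esub> w)"
    if "v \<in> carrier V" "w \<in> carrier V" for v w
    using that by (simp add: quotient_vs_def a_rcos_sum)
  have sc: "c \<odot>\<^bsub>quotient_vs V N\<^esub> (N +>\<^bsub>V\<^esub> v) = N +>\<^bsub>V\<^esub> (c \<odot>\<^bsub>V\<^esub> v)"
    if "c \<in> carrier K" "v \<in> carrier V" for c v
    using that smc by (simp add: quotient_vs_def)
  have ab: "abelian_group (quotient_vs V N)"
  proof (rule abelian_groupI)
    fix x assume "x \<in> carrier (quotient_vs V N)"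
    then obtain v where "v \<in> carrier V" "x = N +>\<^bsub>V\<^esub> v" by auto
    then show "\<exists>y\<in>carrier (quotient_vs V N). y \<oplus>\<^bsub>quotient_vs V N\<^esub> x = \<zero>\<^bsub>quotient_vs V N\<^esub>"
      by (intro bexI[of _ "N +>\<^bsub>V\<^esub> (\<ominus>\<^bsub>V\<^esub> v)"]) (auto simp: ad z V.M.l_neg)
  qed (auto simp: ad z V.M.a_ac)
  have "module K (quotient_vs V N)"
    by (rule moduleI[OF V.R.is_cring ab])
      (auto simp: ad sc V.smult_l_distr V.smult_r_distr V.smult_assoc1)
  then show "vectorspace K (quotient_vs V N)"
    by (intro vectorspace.intro V.field_axioms)
  show "(\<lambda>v. N +>\<^bsub>V\<^esub> v) \<in> module_hom K V (quotient_vs V N)"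
    by (auto simp: module_hom_def ad sc)
qed


definition bilinear_map where
  "bilinear_map K V W Z f \<longleftrightarrow>
    (\<forall>v\<in>carrier V. f v \<in> module_hom K W Z) \<and>
    (\<forall>w\<in>carrier W. (\<lambda>v. f v w) \<in> module_hom K V Z)"

lemma free_gen_carrier:
  fixes K (structure)
  assumes "field K" "s \<in> S"
  shows "free_gen K s \<in> carrier (free_vs K S)"
proof -
  interpret field K by fact
  have "{t. free_gen K s t \<noteq> \<zero>} = {s}" by (auto simp: free_gen_def)
  then show ?thesis using assms by (auto simp: free_vs_carrier) (simp add: free_gen_def)
qed

lemma free_vs_induct [consumes 2, case_names zero add]:
  fixes K (structure)
  assumes K: "field K" and "\<phi> \<in> carrier (free_vs K S)"
    and zero: "P \<zero>\<^bsub>free_vs K S\<^esub>"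
    and add: "\<And>c s \<psi>. \<lbrakk>c \<in> carrier K; s \<in> S; \<psi> \<in> carrier (free_vs K S); P \<psi>\<rbrakk> \<Longrightarrow>
      P (c \<odot>\<^bsub>free_vs K S\<^esub> free_gen K s \<oplus>\<^bsub>free_vs K S\<^esub> \<psi>)"
  shows "P \<phi>"
proof -
  interpret field K by fact
  have "finite {s. \<phi> s \<noteq> \<zero>}" using assms(2) by (simp add: free_vs_carrier)
  then show ?thesis using assms(2)
  proof (induction "{s. \<phi> s \<noteq> \<zero>}" arbitrary: \<phi> rule: finite_psubset_induct)
    case psubset
    show ?case
    proof (cases "{s. \<phi> s \<noteq> \<zero>} = {}")
      case True
      then have "\<phi> = \<zero>\<^bsub>free_vs K S\<^esub>" by (auto simp: free_vs_simps)
      then show ?thesis using zero by simp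
    next
      case False
      then obtain s where s: "\<phi> s \<noteq> \<zero>" by auto
      define \<psi> where "\<psi> = \<phi>(s := \<zero>)"
      have supp: "{t. \<psi> t \<noteq> \<zero>} = {t. \<phi> t \<noteq> \<zero>} - {s}" by (auto simp: \<psi>_def)
      then have "{t. \<psi> t \<noteq> \<zero>} \<subset> {t. \<phi> t \<noteq> \<zero>}" using s by auto
      moreover have \<psi>: "\<psi> \<in> carrier (free_vs K S)"
        using psubset.prems supp by (auto simp: free_vs_carrier) (simp add: \<psi>_def)
      ultimately have "P \<psi>" using psubset.hyps by blast
      moreover have "\<phi> = \<phi> s \<odot>\<^bsub>free_vs K S\<^esub> free_gen K s \<oplus>\<^bsub>free_vs K S\<^esub> \<psi>"
        using psubset.prems by (auto simp: free_vs_carrier free_vs_simps free_gen_def \<psi>_def)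
      ultimately show ?thesis
        using add[OF _ _ \<psi>, of "\<phi> s" s] s psubset.prems by (auto simp: free_vs_carrier)
    qed
  qed
qed

definition free_eval where
  "free_eval K Z f \<phi> = (\<Oplus>\<^bsub>Z\<^esub>p\<in>{p. \<phi> p \<noteq> \<zero>\<^bsub>K\<^esub>}. \<phi> p \<odot>\<^bsub>Z\<^esub> f p)"

lemma free_eval:
  assumes "vectorspace K Z" and f: "f \<in> S \<rightarrow> carrier Z"
  shows "free_eval K Z f \<in> module_hom K (free_vs K S) Z"
    and "s \<in> S \<Longrightarrow> free_eval K Z f (free_gen K s) = f s"
proof -
  interpret Z: vectorspace K Z by fact
  have ev: "free_eval K Z f \<phi> = (\<Oplus>\<^bsub>Z\<^esub>p\<in>U. \<phi> p \<odot>\<^bsub>Z\<^esub> f p)"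
    if "finite U" "U \<subseteq> S" "{p. \<phi> p \<noteq> \<zero>\<^bsub>K\<^esub>} \<subseteq> U" "\<And>p. \<phi> p \<in> carrier K" for \<phi> U
    unfolding free_eval_def
  proof (rule Z.M.add.finprod_mono_neutral_cong_left)
    fix p assume "p \<in> U - {p. \<phi> p \<noteq> \<zero>\<^bsub>K\<^esub>}"
    then have "\<phi> p = \<zero>\<^bsub>K\<^esub>" "f p \<in> carrier Z" using that f by auto
    then show "\<phi> p \<odot>\<^bsub>Z\<^esub> f p = \<zero>\<^bsub>Z\<^esub>" by simp
  qed (use that f in \<open>auto intro!: Z.smult_closed\<close>)
  show "free_eval K Z f \<in> module_hom K (free_vs K S) Z"
    unfolding module_hom_def
  proof (safe)
    fix \<phi> assume \<phi>: "\<phi> \<in> carrier (free_vs K S)"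
    show "free_eval K Z f \<phi> \<in> carrier Z"
      unfolding free_eval_def using \<phi> f by (intro Z.M.finsum_closed) (auto simp: free_vs_carrier)
    fix c assume c: "c \<in> carrier K"
    let ?U = "{p. \<phi> p \<noteq> \<zero>\<^bsub>K\<^esub>}"
    have "free_eval K Z f (c \<odot>\<^bsub>free_vs K S\<^esub> \<phi>) = (\<Oplus>\<^bsub>Z\<^esub>p\<in>?U. (c \<otimes>\<^bsub>K\<^esub> \<phi> p) \<odot>\<^bsub>Z\<^esub> f p)"
      using \<phi> c by (subst ev[of ?U]) (auto simp: free_vs_carrier free_vs_simps)
    also have "\<dots> = (\<Oplus>\<^bsub>Z\<^esub>p\<in>?U. c \<odot>\<^bsub>Z\<^esub> (\<phi> p \<odot>\<^bsub>Z\<^esub> f p))"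
      using \<phi> c f by (intro Z.M.finsum_cong')
        (auto simp: free_vs_carrier Pi_def subset_iff intro!: Z.smult_assoc1 Z.smult_closed)
    also have "\<dots> = c \<odot>\<^bsub>Z\<^esub> free_eval K Z f \<phi>"
      unfolding free_eval_def using \<phi> c f
      by (intro Z.finsum_smult_ldistr[symmetric]) (auto simp: free_vs_carrier)
    finally show "free_eval K Z f (c \<odot>\<^bsub>free_vs K S\<^esub> \<phi>) = c \<odot>\<^bsub>Z\<^esub> free_eval K Z f \<phi>" .
  next
    fix \<phi> \<psi> assume \<phi>: "\<phi> \<in> carrier (free_vs K S)" and \<psi>: "\<psi> \<in> carrier (free_vs K S)"
    let ?U = "{p. \<phi> p \<noteq> \<zero>\<^bsub>K\<^esub>} \<union> {p. \<psi> p \<noteq> \<zero>\<^bsub>K\<^esub>}"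
    have U: "finite ?U" "?U \<subseteq> S" using \<phi> \<psi> by (auto simp: free_vs_carrier)
    have c: "\<And>p. \<phi> p \<in> carrier K" "\<And>p. \<psi> p \<in> carrier K"
      using \<phi> \<psi> by (auto simp: free_vs_carrier)
    have "free_eval K Z f (\<phi> \<oplus>\<^bsub>free_vs K S\<^esub> \<psi>) = (\<Oplus>\<^bsub>Z\<^esub>p\<in>?U. (\<phi> p \<oplus>\<^bsub>K\<^esub> \<psi> p) \<odot>\<^bsub>Z\<^esub> f p)"
      using U c by (subst ev[of ?U]) (auto simp: free_vs_simps)
    also have "\<dots> = (\<Oplus>\<^bsub>Z\<^esub>p\<in>?U. \<phi> p \<odot>\<^bsub>Z\<^esub> f p \<oplus>\<^bsub>Z\<^esub> \<psi> p \<odot>\<^bsub>Z\<^esub> f p)"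
      using U c f by (intro Z.M.finsum_cong')
        (auto simp: Pi_def subset_iff intro!: Z.smult_l_distr Z.M.a_closed Z.smult_closed)
    also have "\<dots> = (\<Oplus>\<^bsub>Z\<^esub>p\<in>?U. \<phi> p \<odot>\<^bsub>Z\<^esub> f p) \<oplus>\<^bsub>Z\<^esub> (\<Oplus>\<^bsub>Z\<^esub>p\<in>?U. \<psi> p \<odot>\<^bsub>Z\<^esub> f p)"
      using U c f by (intro Z.M.finsum_addf) (auto simp: Pi_def subset_iff intro!: Z.smult_closed)
    also have "\<dots> = free_eval K Z f \<phi> \<oplus>\<^bsub>Z\<^esub> free_eval K Z f \<psi>"
      using U c by (simp add: ev[of ?U])
    finally show "free_eval K Z f (\<phi> \<oplus>\<^bsub>free_vs K S\<^esub> \<psi>) = free_eval K Z f \<phi> \<oplus>\<^bsub>Z\<^esub> free_eval K Z f \<psi>" .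
  qed
  show "free_eval K Z f (free_gen K s) = f s" if "s \<in> S"
  proof -
    have "f s \<in> carrier Z" using f that by auto
    then show ?thesis using that by (subst ev[of "{s}"]) (auto simp: free_gen_def split: if_splits)
  qed
qed

context
  fixes K :: "('k, 'm) ring_scheme" and V :: "('k, 'a, 'm1) module_scheme"
    and W :: "('k, 'b, 'm2) module_scheme"
  assumes V: "vectorspace K V" and W: "vectorspace K W"
begin

interpretation V: vectorspace K V by (fact V)
interpretation W: vectorspace K W by (fact W)
interpretation F: vectorspace K "pair_vs K V W"
  by (rule free_vs_vectorspace) (rule V.field_axioms)

lemma gen_in: "v \<in> carrier V \<Longrightarrow> w \<in> carrier W \<Longrightarrow> free_gen K (v, w) \<in> carrier (pair_vs K V W)"
  by (rule free_gen_carrier[OF V.field_axioms]) simp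

lemma rels_in: "tensor_rels K V W \<subseteq> carrier (pair_vs K V W)"
  unfolding tensor_rels_def Let_def
  by (auto intro!: F.M.minus_closed F.M.a_closed F.smult_closed gen_in)

lemma null_submodule: "Module.submodule (tensor_null K V W) K (pair_vs K V W)"
proof -
  have s: "LinearCombinations.submodule K (tensor_null K V W) (pair_vs K V W)"
    unfolding tensor_null_def by (rule F.span_is_submodule[OF rels_in])
  note s' = submodule.subset[OF s] submodule.m_closed[OF s] submodule.zero_closed[OF s]
    submodule.smult_closed[OF s]
  show ?thesis
  proof (rule F.submoduleI)
    fix x assume x: "x \<in> tensor_null K V W"
    then have "\<ominus>\<^bsub>pair_vs K V W\<^esub> x = (\<ominus>\<^bsub>K\<^esub> \<one>\<^bsub>K\<^esub>) \<odot>\<^bsub>pair_vs K V W\<^esub> x"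
      using s' F.smult_minus_1 by auto
    then show "\<ominus>\<^bsub>pair_vs K V W\<^esub> x \<in> tensor_null K V W"
      using x s' by auto
  qed (use s' in auto)
qed

lemma tensor_vectorspace: "vectorspace K (V \<boxtimes>\<^bsub>K\<^esub> W)"
  unfolding tensor_def by (rule quotient_vectorspace(1)[OF F.vectorspace_axioms null_submodule])

lemma proj_hom:
  "(\<lambda>\<phi>. tensor_null K V W +>\<^bsub>pair_vs K V W\<^esub> \<phi>) \<in> module_hom K (pair_vs K V W) (V \<boxtimes>\<^bsub>K\<^esub> W)"
  unfolding tensor_def by (rule quotient_vectorspace(2)[OF F.vectorspace_axioms null_submodule])

lemma rel_eq:
  assumes "\<phi> \<ominus>\<^bsub>pair_vs K V W\<^esub> \<psi> \<in> tensor_rels K V W"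
    "\<phi> \<in> carrier (pair_vs K V W)" "\<psi> \<in> carrier (pair_vs K V W)"
  shows "tensor_null K V W +>\<^bsub>pair_vs K V W\<^esub> \<phi> = tensor_null K V W +>\<^bsub>pair_vs K V W\<^esub> \<psi>"
  using quotient_vectorspace(3)[OF F.vectorspace_axioms null_submodule assms(2,3)]
    F.in_own_span[OF rels_in] assms(1) unfolding tensor_null_def by auto

lemma pt_bilinear: "bilinear_map K V W (V \<boxtimes>\<^bsub>K\<^esub> W) (pt K V W)"
proof -
  note hom = module_hom_add[OF proj_hom] module_hom_smult[OF proj_hom]
    module_hom_closed[OF proj_hom]
  let ?F = "pair_vs K V W" and ?q = "\<lambda>\<phi>. tensor_null K V W +>\<^bsub>pair_vs K V W\<^esub> \<phi>"
  have 1: "?q (free_gen K (v \<oplus>\<^bsub>V\<^esub> v', w)) = ?q (free_gen K (v, w) \<oplus>\<^bsub>?F\<^esub> free_gen K (v', w))"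
    if "v \<in> carrier V" "v' \<in> carrier V" "w \<in> carrier W" for v v' w
    by (rule rel_eq) (use that in \<open>auto simp: tensor_rels_def Let_def intro!: gen_in F.M.a_closed\<close>)
  have 2: "?q (free_gen K (v, w \<oplus>\<^bsub>W\<^esub> w')) = ?q (free_gen K (v, w) \<oplus>\<^bsub>?F\<^esub> free_gen K (v, w'))"
    if "v \<in> carrier V" "w \<in> carrier W" "w' \<in> carrier W" for v w w'
    by (rule rel_eq) (use that in \<open>auto simp: tensor_rels_def Let_def intro!: gen_in F.M.a_closed\<close>)
  have 3: "?q (free_gen K (c \<odot>\<^bsub>V\<^esub> v, w)) = ?q (c \<odot>\<^bsub>?F\<^esub> free_gen K (v, w))"
    if "c \<in> carrier K" "v \<in> carrier V" "w \<in> carrier W" for c v w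
    by (rule rel_eq) (use that in \<open>auto simp: tensor_rels_def Let_def intro!: gen_in F.smult_closed\<close>)
  have 4: "?q (free_gen K (v, c \<odot>\<^bsub>W\<^esub> w)) = ?q (c \<odot>\<^bsub>?F\<^esub> free_gen K (v, w))"
    if "c \<in> carrier K" "v \<in> carrier V" "w \<in> carrier W" for c v w
    by (rule rel_eq) (use that in \<open>auto simp: tensor_rels_def Let_def intro!: gen_in F.smult_closed\<close>)
  show ?thesis
    unfolding bilinear_map_def module_hom_def pt_def
    using hom(3) by (auto simp: 1 2 3 4 hom(1,2) gen_in)
qed

lemma tensor_carrier:
  "X \<in> carrier (V \<boxtimes>\<^bsub>K\<^esub> W) \<longleftrightarrow>
    (\<exists>\<phi>\<in>carrier (pair_vs K V W). X = tensor_null K V W +>\<^bsub>pair_vs K V W\<^esub> \<phi>)"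
  by (auto simp: tensor_def quotient_vs_def A_RCOSETS_def')

lemma tensor_hom_ext:
  assumes Z: "vectorspace K Z"
    and g: "g \<in> module_hom K (V \<boxtimes>\<^bsub>K\<^esub> W) Z" and h: "h \<in> module_hom K (V \<boxtimes>\<^bsub>K\<^esub> W) Z"
    and eq: "\<And>v w. \<lbrakk>v \<in> carrier V; w \<in> carrier W\<rbrakk> \<Longrightarrow> g (pt K V W v w) = h (pt K V W v w)"
    and X: "X \<in> carrier (V \<boxtimes>\<^bsub>K\<^esub> W)"
  shows "g X = h X"
proof -
  interpret Z: vectorspace K Z by fact
  interpret T: vectorspace K "V \<boxtimes>\<^bsub>K\<^esub> W" by (rule tensor_vectorspace)
  interpret g: mod_hom K "V \<boxtimes>\<^bsub>K\<^esub> W" Z g using g by unfold_locales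
  interpret h: mod_hom K "V \<boxtimes>\<^bsub>K\<^esub> W" Z h using h by unfold_locales
  interpret q: mod_hom K "pair_vs K V W" "V \<boxtimes>\<^bsub>K\<^esub> W" "\<lambda>\<phi>. tensor_null K V W +>\<^bsub>pair_vs K V W\<^esub> \<phi>"
    using proj_hom by unfold_locales
  let ?q = "\<lambda>\<phi>. tensor_null K V W +>\<^bsub>pair_vs K V W\<^esub> \<phi>"
  obtain \<phi> where \<phi>: "\<phi> \<in> carrier (pair_vs K V W)" "X = ?q \<phi>" using X tensor_carrier by blast
  from V.field_axioms \<phi>(1) have "g (?q \<phi>) = h (?q \<phi>)"
  proof (induction rule: free_vs_induct)
    case zero
    then show ?case by simp
  next
    case (add c s \<psi>)
    obtain v w where s: "s = (v, w)" "v \<in> carrier V" "w \<in> carrier W" using add by auto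
    have "g (?q (free_gen K s)) = h (?q (free_gen K s))" using eq s by (simp add: pt_def)
    then show ?case using add s gen_in by (simp add: q.f_add q.f_smult)
  qed
  then show ?thesis using \<phi> by simp
qed

context
  fixes Z :: "('k, 'z, 'm3) module_scheme" and f :: "'a \<Rightarrow> 'b \<Rightarrow> 'z"
  assumes Z: "vectorspace K Z" and f: "bilinear_map K V W Z f"
begin

interpretation Z: vectorspace K Z by (fact Z)

lemma f_in: "case_prod f \<in> carrier V \<times> carrier W \<rightarrow> carrier Z"
  using f by (auto simp: bilinear_map_def module_hom_def)

lemma f_simps:
  "\<lbrakk>v \<in> carrier V; v' \<in> carrier V; w \<in> carrier W\<rbrakk> \<Longrightarrow> f (v \<oplus>\<^bsub>V\<^esub> v') w = f v w \<oplus>\<^bsub>Z\<^esub> f v' w"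
  "\<lbrakk>v \<in> carrier V; w \<in> carrier W; w' \<in> carrier W\<rbrakk> \<Longrightarrow> f v (w \<oplus>\<^bsub>W\<^esub> w') = f v w \<oplus>\<^bsub>Z\<^esub> f v w'"
  "\<lbrakk>c \<in> carrier K; v \<in> carrier V; w \<in> carrier W\<rbrakk> \<Longrightarrow> f (c \<odot>\<^bsub>V\<^esub> v) w = c \<odot>\<^bsub>Z\<^esub> f v w"
  "\<lbrakk>c \<in> carrier K; v \<in> carrier V; w \<in> carrier W\<rbrakk> \<Longrightarrow> f v (c \<odot>\<^bsub>W\<^esub> w) = c \<odot>\<^bsub>Z\<^esub> f v w"
  "\<lbrakk>v \<in> carrier V; w \<in> carrier W\<rbrakk> \<Longrightarrow> f v w \<in> carrier Z"
  using f by (auto simp: bilinear_map_def module_hom_def)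

interpretation ev: mod_hom K "pair_vs K V W" Z "free_eval K Z (case_prod f)"
  using free_eval(1)[OF Z f_in] by unfold_locales

lemma ev_gen: "\<lbrakk>v \<in> carrier V; w \<in> carrier W\<rbrakk> \<Longrightarrow> free_eval K Z (case_prod f) (free_gen K (v, w)) = f v w"
  using free_eval(2)[OF Z f_in, of "(v, w)"] by simp

lemma ev_null:
  assumes "\<phi> \<in> tensor_null K V W" shows "free_eval K Z (case_prod f) \<phi> = \<zero>\<^bsub>Z\<^esub>"
proof -
  have "tensor_rels K V W \<subseteq> ev.ker"
    unfolding tensor_rels_def Let_def ev.ker_def
    by (auto simp: gen_in ev_gen f_simps Z.M.r_neg Z.M.minus_eq
        intro!: F.M.minus_closed F.M.a_closed F.smult_closed gen_in)
  then have "tensor_null K V W \<subseteq> ev.ker"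
    unfolding tensor_null_def by (rule F.span_is_subset) (rule ev.ker_is_submodule)
  then show ?thesis using assms by (auto simp: ev.ker_def)
qed

lemma lift_eval:
  assumes "\<phi> \<in> carrier (pair_vs K V W)"
  shows "tensor_lift K Z f (tensor_null K V W +>\<^bsub>pair_vs K V W\<^esub> \<phi>) = free_eval K Z (case_prod f) \<phi>"
proof -
  interpret N: Module.submodule "tensor_null K V W" K "pair_vs K V W"
    by (rule null_submodule)
  have "free_eval K Z (case_prod f) ` (tensor_null K V W +>\<^bsub>pair_vs K V W\<^esub> \<phi>) =
    {free_eval K Z (case_prod f) \<phi>}"
  proof -
    have "free_eval K Z (case_prod f) (n \<oplus>\<^bsub>pair_vs K V W\<^esub> \<phi>) = free_eval K Z (case_prod f) \<phi>"
      if n: "n \<in> tensor_null K V W" for n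
      using N.subset that assms by (subst ev.f_add) (auto simp: ev_null[OF n])
    moreover have "tensor_null K V W \<noteq> {}" using N.one_closed by auto
    ultimately show ?thesis unfolding a_r_coset_def' by (auto simp: image_UN)
  qed
  moreover have "(\<lambda>\<phi>. \<Oplus>\<^bsub>Z\<^esub>p\<in>{p. \<phi> p \<noteq> \<zero>\<^bsub>K\<^esub>}. \<phi> p \<odot>\<^bsub>Z\<^esub> f (fst p) (snd p)) = free_eval K Z (case_prod f)"
    by (auto simp: free_eval_def case_prod_beta')
  ultimately show ?thesis unfolding tensor_lift_def by (metis the_elem_eq)
qed

lemma tensor_lift_pt:
  "\<lbrakk>v \<in> carrier V; w \<in> carrier W\<rbrakk> \<Longrightarrow> tensor_lift K Z f (pt K V W v w) = f v w"
  by (simp add: pt_def lift_eval gen_in ev_gen)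

lemma tensor_lift_hom: "tensor_lift K Z f \<in> module_hom K (V \<boxtimes>\<^bsub>K\<^esub> W) Z"
proof -
  note hom = module_hom_add[OF proj_hom, symmetric] module_hom_smult[OF proj_hom, symmetric]
  show ?thesis
    unfolding module_hom_def
    by (auto simp: tensor_carrier hom lift_eval)
qed

end

end


section \<open>BiHom-associative algebras, twisting maps and pseudotwistors\<close>

text \<open>Linear maps are the elements of \<open>module_hom\<close>; as usual for carrier-based structures, only
  their values on the carrier matter, and equations between them are relativised to it.\<close>

locale bihom_assoc_algebra = vectorspace K A
  for K :: "('k, 'm) ring_scheme" and A :: "('k, 'a, 'n) module_scheme" +
  fixes \<mu> :: "('a \<times> 'a \<Rightarrow> 'k) set \<Rightarrow> 'a" and \<alpha> \<beta> :: "'a \<Rightarrow> 'a"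
  assumes mu_linear: "\<mu> \<in> module_hom K (A \<boxtimes>\<^bsub>K\<^esub> A) A"
    and alpha_linear: "\<alpha> \<in> module_hom K A A"
    and beta_linear: "\<beta> \<in> module_hom K A A"
    and alpha_beta: "a \<in> carrier A \<Longrightarrow> \<alpha> (\<beta> a) = \<beta> (\<alpha> a)"
    and alpha_mult: "\<lbrakk>a \<in> carrier A; a' \<in> carrier A\<rbrakk> \<Longrightarrow>
      \<alpha> (\<mu> (pt K A A a a')) = \<mu> (pt K A A (\<alpha> a) (\<alpha> a'))"
    and beta_mult: "\<lbrakk>a \<in> carrier A; a' \<in> carrier A\<rbrakk> \<Longrightarrow>
      \<beta> (\<mu> (pt K A A a a')) = \<mu> (pt K A A (\<beta> a) (\<beta> a'))"
    and bihom_assoc: "\<lbrakk>a \<in> carrier A; a' \<in> carrier A; a'' \<in> carrier A\<rbrakk> \<Longrightarrow>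
      \<mu> (pt K A A (\<alpha> a) (\<mu> (pt K A A a' a''))) = \<mu> (pt K A A (\<mu> (pt K A A a a')) (\<beta> a''))"

text \<open>The multiplication \<open>(a \<otimes> b)(a' \<otimes> b') = aa' \<otimes> bb'\<close>.\<close>

definition tensor_mult where
  "tensor_mult K A \<mu>\<^sub>A B \<mu>\<^sub>B =
    tensor_lift4 K (A \<boxtimes>\<^bsub>K\<^esub> B) (\<lambda>a b a' b'. pt K A B (\<mu>\<^sub>A (pt K A A a a')) (\<mu>\<^sub>B (pt K B B b b')))"

locale bihom_twisting_map =
  A: bihom_assoc_algebra K A \<mu>\<^sub>A \<alpha>\<^sub>A \<beta>\<^sub>A + B: bihom_assoc_algebra K B \<mu>\<^sub>B \<alpha>\<^sub>B \<beta>\<^sub>B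
  for K :: "('k, 'm) ring_scheme"
    and A :: "('k, 'a, 'n1) module_scheme" and \<mu>\<^sub>A \<alpha>\<^sub>A \<beta>\<^sub>A
    and B :: "('k, 'b, 'n2) module_scheme" and \<mu>\<^sub>B \<alpha>\<^sub>B \<beta>\<^sub>B +
  fixes R :: "('b \<times> 'a \<Rightarrow> 'k) set \<Rightarrow> ('a \<times> 'b \<Rightarrow> 'k) set"
  assumes bij_alphaA: "bij_betw \<alpha>\<^sub>A (carrier A) (carrier A)"
    and bij_betaA: "bij_betw \<beta>\<^sub>A (carrier A) (carrier A)"
    and bij_alphaB: "bij_betw \<alpha>\<^sub>B (carrier B) (carrier B)"
    and bij_betaB: "bij_betw \<beta>\<^sub>B (carrier B) (carrier B)"
    and R_linear: "R \<in> module_hom K (B \<boxtimes>\<^bsub>K\<^esub> A) (A \<boxtimes>\<^bsub>K\<^esub> B)"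
    and R_alpha: "\<And>x. x \<in> carrier (B \<boxtimes>\<^bsub>K\<^esub> A) \<Longrightarrow>
      (tensor_map K A B \<alpha>\<^sub>A \<alpha>\<^sub>B \<circ> R) x = (R \<circ> tensor_map K B A \<alpha>\<^sub>B \<alpha>\<^sub>A) x"
    and R_beta: "\<And>x. x \<in> carrier (B \<boxtimes>\<^bsub>K\<^esub> A) \<Longrightarrow>
      (tensor_map K A B \<beta>\<^sub>A \<beta>\<^sub>B \<circ> R) x = (R \<circ> tensor_map K B A \<beta>\<^sub>B \<beta>\<^sub>A) x"
    and R_multA: "\<And>x. x \<in> carrier ((B \<boxtimes>\<^bsub>K\<^esub> A) \<boxtimes>\<^bsub>K\<^esub> A) \<Longrightarrow>
      (R \<circ> tensor_map K B A \<alpha>\<^sub>B \<mu>\<^sub>A \<circ> tassoc K B A A) x =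
      (tensor_map K A B \<mu>\<^sub>A \<beta>\<^sub>B \<circ> tassoc_inv K A A B
        \<circ> tensor_map K A (A \<boxtimes>\<^bsub>K\<^esub> B) id R
        \<circ> tensor_map K A (B \<boxtimes>\<^bsub>K\<^esub> A) id (tensor_map K B A (\<alpha>\<^sub>B \<circ> inv_into (carrier B) \<beta>\<^sub>B) id)
        \<circ> tassoc K A B A
        \<circ> tensor_map K (A \<boxtimes>\<^bsub>K\<^esub> B) A R id) x"
    and R_multB: "\<And>x. x \<in> carrier ((B \<boxtimes>\<^bsub>K\<^esub> B) \<boxtimes>\<^bsub>K\<^esub> A) \<Longrightarrow>
      (R \<circ> tensor_map K B A \<mu>\<^sub>B \<beta>\<^sub>A) x =
      (tensor_map K A B \<alpha>\<^sub>A \<mu>\<^sub>B \<circ> tassoc K A B B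
        \<circ> tensor_map K (A \<boxtimes>\<^bsub>K\<^esub> B) B R id
        \<circ> tensor_map K (B \<boxtimes>\<^bsub>K\<^esub> A) B (tensor_map K B A id (inv_into (carrier A) \<alpha>\<^sub>A \<circ> \<beta>\<^sub>A)) id
        \<circ> tassoc_inv K B A B
        \<circ> tensor_map K B (A \<boxtimes>\<^bsub>K\<^esub> B) id R
        \<circ> tassoc K B B A) x"

text \<open>\<open>T \<otimes> id\<close> and \<open>id \<otimes> T\<close> as endomorphisms of \<open>(D \<otimes> D) \<otimes> D\<close>, and \<open>T\<close> acting on the first and
  third factor: \<open>x \<otimes> y \<otimes> z\<close> goes to the image of \<open>T (x \<otimes> z)\<close> under \<open>p \<otimes> q \<mapsto> p \<otimes> y \<otimes> q\<close>.\<close>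

definition act12 where
  "act12 K D T = tensor_map K (D \<boxtimes>\<^bsub>K\<^esub> D) D T id"

definition act23 where
  "act23 K D T = tassoc_inv K D D D \<circ> tensor_map K D (D \<boxtimes>\<^bsub>K\<^esub> D) id T \<circ> tassoc K D D D"

definition act13 where
  "act13 K D T =
    tensor_lift3 K ((D \<boxtimes>\<^bsub>K\<^esub> D) \<boxtimes>\<^bsub>K\<^esub> D)
      (\<lambda>x y z. tensor_lift K ((D \<boxtimes>\<^bsub>K\<^esub> D) \<boxtimes>\<^bsub>K\<^esub> D)
        (\<lambda>p q. pt K (D \<boxtimes>\<^bsub>K\<^esub> D) D (pt K D D p y) q) (T (pt K D D x z)))"

locale bihom_pseudotwistor = bihom_assoc_algebra K D \<mu> \<alpha> \<beta>
  for K :: "('k, 'm) ring_scheme" and D :: "('k, 'd, 'n) module_scheme" and \<mu> \<alpha> \<beta> +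
  fixes T :: "('d \<times> 'd \<Rightarrow> 'k) set \<Rightarrow> ('d \<times> 'd \<Rightarrow> 'k) set"
    and T\<^sub>1 T\<^sub>2 :: "(('d \<times> 'd \<Rightarrow> 'k) set \<times> 'd \<Rightarrow> 'k) set \<Rightarrow> (('d \<times> 'd \<Rightarrow> 'k) set \<times> 'd \<Rightarrow> 'k) set"
  assumes T_linear: "T \<in> module_hom K (D \<boxtimes>\<^bsub>K\<^esub> D) (D \<boxtimes>\<^bsub>K\<^esub> D)"
    and T1_linear: "T\<^sub>1 \<in> module_hom K ((D \<boxtimes>\<^bsub>K\<^esub> D) \<boxtimes>\<^bsub>K\<^esub> D) ((D \<boxtimes>\<^bsub>K\<^esub> D) \<boxtimes>\<^bsub>K\<^esub> D)"
    and T2_linear: "T\<^sub>2 \<in> module_hom K ((D \<boxtimes>\<^bsub>K\<^esub> D) \<boxtimes>\<^bsub>K\<^esub> D) ((D \<boxtimes>\<^bsub>K\<^esub> D) \<boxtimes>\<^bsub>K\<^esub> D)"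
    and T_alpha: "\<And>x. x \<in> carrier (D \<boxtimes>\<^bsub>K\<^esub> D) \<Longrightarrow>
      (tensor_map K D D \<alpha> \<alpha> \<circ> T) x = (T \<circ> tensor_map K D D \<alpha> \<alpha>) x"
    and T_beta: "\<And>x. x \<in> carrier (D \<boxtimes>\<^bsub>K\<^esub> D) \<Longrightarrow>
      (tensor_map K D D \<beta> \<beta> \<circ> T) x = (T \<circ> tensor_map K D D \<beta> \<beta>) x"
    and T_mult_right: "\<And>x. x \<in> carrier ((D \<boxtimes>\<^bsub>K\<^esub> D) \<boxtimes>\<^bsub>K\<^esub> D) \<Longrightarrow>
      (T \<circ> tensor_map K D D \<alpha> \<mu> \<circ> tassoc K D D D) x =
      (tensor_map K D D \<alpha> \<mu> \<circ> tassoc K D D D \<circ> T\<^sub>1 \<circ> act12 K D T) x"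
    and T_mult_left: "\<And>x. x \<in> carrier ((D \<boxtimes>\<^bsub>K\<^esub> D) \<boxtimes>\<^bsub>K\<^esub> D) \<Longrightarrow>
      (T \<circ> tensor_map K D D \<mu> \<beta>) x = (tensor_map K D D \<mu> \<beta> \<circ> T\<^sub>2 \<circ> act23 K D T) x"
    and T_compat: "\<And>x. x \<in> carrier ((D \<boxtimes>\<^bsub>K\<^esub> D) \<boxtimes>\<^bsub>K\<^esub> D) \<Longrightarrow>
      (T\<^sub>1 \<circ> act12 K D T \<circ> act23 K D T) x = (T\<^sub>2 \<circ> act23 K D T \<circ> act12 K D T) x"

text \<open>\<open>T ((a \<otimes> b) \<otimes> (a' \<otimes> b')) = (a \<otimes> b\<^sub>R) \<otimes> (a'\<^sub>R \<otimes> b')\<close>.  An expression in \<open>a'\<^sub>R \<otimes> b\<^sub>R\<close> denotes the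
  image of \<open>R (b \<otimes> a')\<close> under the linear map obtained by replacing \<open>a'\<^sub>R\<close> and \<open>b\<^sub>R\<close> by variables
  \<open>x\<close> and \<open>y\<close>.\<close>

definition twistor_of where
  "twistor_of K A B R =
    (let D = A \<boxtimes>\<^bsub>K\<^esub> B in
      tensor_lift4 K (D \<boxtimes>\<^bsub>K\<^esub> D) (\<lambda>a b a' b'.
        tensor_lift K (D \<boxtimes>\<^bsub>K\<^esub> D) (\<lambda>x y. pt K D D (pt K A B a y) (pt K A B x b')) (R (pt K B A b a'))))"

end

theory Submission
  imports Defs
begin

text \<open>
  Since \<open>T\<close> only moves the inner factors of \<open>(A \<otimes> B) \<otimes> (A \<otimes> B)\<close>, each axiom of a pseudotwistor is
  checked on pure tensors: there both sides are linear in \<open>X = R (b \<otimes> a')\<close>, so \<open>X\<close> may in turn be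
  taken pure, and likewise for a second application of \<open>R\<close>.  The two multiplicativity axioms then
  become those of \<open>R\<close>.  As \<open>R\<close> commutes with \<open>\<alpha>\<beta>\<^sup>-\<^sup>1 \<otimes> \<alpha>\<beta>\<^sup>-\<^sup>1\<close>, the two companions coincide, and the
  compatibility axiom reduces to the fact that \<open>T \<otimes> id\<close> and \<open>id \<otimes> T\<close> commute, because they act on
  disjoint tensor factors.
\<close>

section \<open>Linear maps between tensor products\<close>

text \<open>The companions repair a mismatch of structure maps. In the twisting axiom for
  \<open>\<mu>\<^sub>A\<close>, the second application of \<open>R\<close> receives
  \<open>\<alpha>\<^sub>B \<beta>\<^sub>B\<^sup>-\<^sup>1\<close> of the B-component left by the
  first, and the resulting B-component ends under \<open>\<beta>\<^sub>B\<close>. The pseudotwistor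
  axiom puts \<open>\<alpha>\<^sub>B\<close> on that component instead. Conjugating the action on
  factors 1 and 3 at this one slot settles both points: the map applied before supplies
  \<open>\<alpha>\<^sub>B \<beta>\<^sub>B\<^sup>-\<^sup>1\<close>, and the map applied after turns
  \<open>\<alpha>\<^sub>B\<close> into \<open>\<beta>\<^sub>B\<close>. For
  \<open>\<mu>\<^sub>B\<close> the slot is the A-component of the third factor, where
  \<open>R\<close> receives \<open>\<alpha>\<^sub>A\<^sup>-\<^sup>1 \<beta>\<^sub>A\<close> and
  \<open>\<beta>\<^sub>A\<close> has to become \<open>\<alpha>\<^sub>A\<close>.

  Two applications of \<open>R\<close> give a lift whose bilinear map depends on the value of the
  other application. Linearity of a lift in a parameter of the lifted map is therefore needed as
  well as linearity in its tensor argument.\<close>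

lemma hom_closed: "f \<in> module_hom K V W \<Longrightarrow> x \<in> carrier V \<Longrightarrow> f x \<in> carrier W"
  by (auto simp: module_hom_def)

lemma hom_ident: "(\<lambda>x. x) \<in> module_hom K V V"
  by (auto simp: module_hom_def)

lemma hom_id: "id \<in> module_hom K V V"
  by (auto simp: module_hom_def)

lemma hom_compose: "f \<in> module_hom K V W \<Longrightarrow> g \<in> module_hom K U V \<Longrightarrow> (\<lambda>x. f (g x)) \<in> module_hom K U W"
  by (auto simp: module_hom_def Pi_def)

lemma hom_comp: "f \<in> module_hom K V W \<Longrightarrow> g \<in> module_hom K U V \<Longrightarrow> f \<circ> g \<in> module_hom K U W"
  by (auto simp: module_hom_def Pi_def)

lemma hom_sum:
  assumes "vectorspace K V" "vectorspace K W" "f \<in> module_hom K V W" "g \<in> module_hom K V W"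
  shows "(\<lambda>x. f x \<oplus>\<^bsub>W\<^esub> g x) \<in> module_hom K V W"
proof -
  interpret V: vectorspace K V by fact
  interpret W: vectorspace K W by fact
  show ?thesis using assms(3,4)
    by (auto simp: module_hom_def Pi_def W.M.a_ac W.smult_r_distr)
qed

lemma hom_scale:
  assumes "vectorspace K V" "vectorspace K W" "f \<in> module_hom K V W" "c \<in> carrier K"
  shows "(\<lambda>x. c \<odot>\<^bsub>W\<^esub> f x) \<in> module_hom K V W"
proof -
  interpret V: vectorspace K V by fact
  interpret W: vectorspace K W by fact
  show ?thesis using assms(3,4)
    by (auto simp: module_hom_def Pi_def W.smult_r_distr W.smult_assoc1[symmetric] V.R.m_comm)
qed

lemma hom_inv_into:
  assumes V: "vectorspace K V" and f: "f \<in> module_hom K V W" and b: "bij_betw f (carrier V) (carrier W)"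
  shows "inv_into (carrier V) f \<in> module_hom K W V"
proof -
  interpret V: vectorspace K V by fact
  let ?g = "inv_into (carrier V) f"
  have g: "?g y \<in> carrier V" "f (?g y) = y" if "y \<in> carrier W" for y
    using b that by (auto simp: bij_betw_def inv_into_into f_inv_into_f)
  have inj: "x = y" if "x \<in> carrier V" "y \<in> carrier V" "f x = f y" for x y
    using b that by (auto simp: bij_betw_def inj_on_def)
  have W: "f x \<in> carrier W" if "x \<in> carrier V" for x using f that by (rule hom_closed)
  show ?thesis
    unfolding module_hom_def
  proof (safe)
    fix x y assume xy: "x \<in> carrier W" "y \<in> carrier W"
    have "f (?g x \<oplus>\<^bsub>V\<^esub> ?g y) = x \<oplus>\<^bsub>W\<^esub> y" using module_hom_add[OF f] g xy by simp
    \<comment> \<open>The sum lies in \<open>carrier W\<close> because it is the image under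
      \<open>f\<close> of a sum in \<open>V\<close>.\<close>
    moreover have "x \<oplus>\<^bsub>W\<^esub> y \<in> carrier W" using W g xy calculation by (metis V.M.a_closed)
    ultimately show "?g (x \<oplus>\<^bsub>W\<^esub> y) = ?g x \<oplus>\<^bsub>V\<^esub> ?g y" using g xy by (intro inj) auto
  next
    fix c x assume c: "c \<in> carrier K" "x \<in> carrier W"
    have "f (c \<odot>\<^bsub>V\<^esub> ?g x) = c \<odot>\<^bsub>W\<^esub> x" using module_hom_smult[OF f] g c by simp
    moreover have "c \<odot>\<^bsub>W\<^esub> x \<in> carrier W" using W g c calculation by (metis V.smult_closed)
    ultimately show "?g (c \<odot>\<^bsub>W\<^esub> x) = c \<odot>\<^bsub>V\<^esub> ?g x" using g c by (intro inj) auto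
  qed (use g in auto)
qed

lemma bilinear_mapI:
  assumes "\<And>v. v \<in> carrier V \<Longrightarrow> (\<lambda>w. f v w) \<in> module_hom K W Z"
    and "\<And>w. w \<in> carrier W \<Longrightarrow> (\<lambda>v. f v w) \<in> module_hom K V Z"
  shows "bilinear_map K V W Z f"
  using assms by (auto simp: bilinear_map_def)

lemma bilinear_mapD:
  assumes "bilinear_map K V W Z f"
  shows "v \<in> carrier V \<Longrightarrow> (\<lambda>w. f v w) \<in> module_hom K W Z"
    and "w \<in> carrier W \<Longrightarrow> (\<lambda>v. f v w) \<in> module_hom K V Z"
    and "v \<in> carrier V \<Longrightarrow> w \<in> carrier W \<Longrightarrow> f v w \<in> carrier Z"
  using assms by (auto simp: bilinear_map_def module_hom_def)

section \<open>Linearity of nested pure tensors and lifts in each of their variables\<close>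

context
  fixes K :: "('k, 'm) ring_scheme" (structure)
begin

text \<open>Together with \<open>hom_pt_right\<close>, \<open>hom_lift\<close> and
  \<open>hom_lift_parameter\<close>, this is an introduction rule that follows the variable through
  a nested expression, so that multilinearity goals are solved by \<open>intro\<close>.\<close>

lemma hom_pt_left:
  assumes "vectorspace K V" "vectorspace K W" "g \<in> module_hom K U V" "w \<in> carrier W"
  shows "(\<lambda>x. pt K V W (g x) w) \<in> module_hom K U (V \<boxtimes> W)"
  by (rule hom_compose[OF bilinear_mapD(2)[OF pt_bilinear[OF assms(1,2)] assms(4)] assms(3)])

lemma hom_pt_right:
  assumes "vectorspace K V" "vectorspace K W" "v \<in> carrier V" "g \<in> module_hom K U W"
  shows "(\<lambda>x. pt K V W v (g x)) \<in> module_hom K U (V \<boxtimes> W)"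
  by (rule hom_compose[OF bilinear_mapD(1)[OF pt_bilinear[OF assms(1,2)] assms(3)] assms(4)])

lemma pt_closed:
  assumes "vectorspace K V" "vectorspace K W" "v \<in> carrier V" "w \<in> carrier W"
  shows "pt K V W v w \<in> carrier (V \<boxtimes> W)"
  by (rule bilinear_mapD(3)[OF pt_bilinear[OF assms(1,2)] assms(3,4)])

lemma hom_lift:
  assumes "vectorspace K V" "vectorspace K W" "vectorspace K Z"
    "g \<in> module_hom K U (V \<boxtimes> W)" "bilinear_map K V W Z f"
  shows "(\<lambda>x. tensor_lift K Z f (g x)) \<in> module_hom K U Z"
  by (rule hom_compose[OF tensor_lift_hom[OF assms(1-3,5)] assms(4)])

text \<open>For fixed parameters, additivity and homogeneity are equations between linear maps of
  the tensor \<open>c\<close>. They hold on pure tensors by the linearity of \<open>f\<close>, hence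
  at every \<open>c\<close>.\<close>

lemma hom_lift_parameter:
  assumes VW: "vectorspace K V" "vectorspace K W" "vectorspace K Z" and U: "vectorspace K U"
    and c: "c \<in> carrier (V \<boxtimes> W)"
    and bil: "\<And>x. x \<in> carrier U \<Longrightarrow> bilinear_map K V W Z (f x)"
    and f: "\<And>v w. v \<in> carrier V \<Longrightarrow> w \<in> carrier W \<Longrightarrow> (\<lambda>x. f x v w) \<in> module_hom K U Z"
  shows "(\<lambda>x. tensor_lift K Z (f x) c) \<in> module_hom K U Z"
proof -
  interpret U: vectorspace K U by fact
  note hom = tensor_lift_hom[OF VW bil] tensor_vectorspace[OF VW(1,2)]
  note pt = tensor_lift_pt[OF VW bil]
  show ?thesis
    unfolding module_hom_def
  proof (safe)
    fix x assume x: "x \<in> carrier U"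
    show "tensor_lift K Z (f x) c \<in> carrier Z" by (rule hom_closed[OF hom(1)[OF x] c])
  next
    fix x y assume xy: "x \<in> carrier U" "y \<in> carrier U"
    show "tensor_lift K Z (f (x \<oplus>\<^bsub>U\<^esub> y)) c = tensor_lift K Z (f x) c \<oplus>\<^bsub>Z\<^esub> tensor_lift K Z (f y) c"
      by (rule tensor_hom_ext[OF VW _ _ _ c])
        (use xy in \<open>auto intro!: hom hom_sum VW simp: pt module_hom_add[OF f]\<close>)
  next
    fix r x assume rx: "r \<in> carrier K" "x \<in> carrier U"
    show "tensor_lift K Z (f (r \<odot>\<^bsub>U\<^esub> x)) c = r \<odot>\<^bsub>Z\<^esub> tensor_lift K Z (f x) c"
      by (rule tensor_hom_ext[OF VW _ _ _ c])
        (use rx in \<open>auto intro!: hom hom_scale VW simp: pt module_hom_smult[OF f]\<close>)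
  qed
qed

lemma bilinear_tensor_map:
  assumes "vectorspace K V'" "vectorspace K W'" "f \<in> module_hom K V V'" "g \<in> module_hom K W W'"
  shows "bilinear_map K V W (V' \<boxtimes> W') (\<lambda>v w. pt K V' W' (f v) (g w))"
  by (intro bilinear_mapI hom_pt_left hom_pt_right assms hom_closed[OF assms(3)] hom_closed[OF assms(4)])

lemma tensor_map_pt:
  assumes "vectorspace K V" "vectorspace K W" "vectorspace K V'" "vectorspace K W'"
    "f \<in> module_hom K V V'" "g \<in> module_hom K W W'" "v \<in> carrier V" "w \<in> carrier W"
  shows "tensor_map K V' W' f g (pt K V W v w) = pt K V' W' (f v) (g w)"
  unfolding tensor_map_def
  by (rule tensor_lift_pt[OF assms(1,2) tensor_vectorspace bilinear_tensor_map]) fact+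

lemma tensor_map_hom:
  assumes "vectorspace K V" "vectorspace K W" "vectorspace K V'" "vectorspace K W'"
    "f \<in> module_hom K V V'" "g \<in> module_hom K W W'"
  shows "tensor_map K V' W' f g \<in> module_hom K (V \<boxtimes> W) (V' \<boxtimes> W')"
  unfolding tensor_map_def
  by (rule tensor_lift_hom[OF assms(1,2) tensor_vectorspace bilinear_tensor_map]) fact+

lemma tensor_lift3:
  assumes vs: "vectorspace K U" "vectorspace K V" "vectorspace K W" "vectorspace K Z"
    and f1: "\<And>v w. \<lbrakk>v \<in> carrier V; w \<in> carrier W\<rbrakk> \<Longrightarrow> (\<lambda>u. f u v w) \<in> module_hom K U Z"
    and f2: "\<And>u w. \<lbrakk>u \<in> carrier U; w \<in> carrier W\<rbrakk> \<Longrightarrow> (\<lambda>v. f u v w) \<in> module_hom K V Z"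
    and f3: "\<And>u v. \<lbrakk>u \<in> carrier U; v \<in> carrier V\<rbrakk> \<Longrightarrow> (\<lambda>w. f u v w) \<in> module_hom K W Z"
  shows "tensor_lift3 K Z f \<in> module_hom K ((U \<boxtimes> V) \<boxtimes> W) Z"
    and "\<lbrakk>u \<in> carrier U; v \<in> carrier V; w \<in> carrier W\<rbrakk> \<Longrightarrow>
      tensor_lift3 K Z f (pt K (U \<boxtimes> V) W (pt K U V u v) w) = f u v w"
proof -
  have uv: "vectorspace K (U \<boxtimes> V)" using vs by (intro tensor_vectorspace)
  have b: "bilinear_map K U V Z (\<lambda>u v. f u v w)" if "w \<in> carrier W" for w
    using that by (intro bilinear_mapI f1 f2)
  have b': "bilinear_map K (U \<boxtimes> V) W Z (\<lambda>x w. tensor_lift K Z (\<lambda>u v. f u v w) x)"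
    \<comment> \<open>The factors from which \<open>tensor_lift\<close> lifts do not occur in the
      conclusion of the rule, so they are supplied by hand.\<close>
    by (intro bilinear_mapI hom_lift_parameter[where V = U and W = V]
        hom_lift[where V = U and W = V] vs b f3 hom_ident)
  show "tensor_lift3 K Z f \<in> module_hom K ((U \<boxtimes> V) \<boxtimes> W) Z"
    unfolding tensor_lift3_def by (rule tensor_lift_hom[OF uv vs(3,4) b'])
  have *: "tensor_lift3 K Z f (pt K (U \<boxtimes> V) W x w) = tensor_lift K Z (\<lambda>u v. f u v w) x"
    if "x \<in> carrier (U \<boxtimes> V)" "w \<in> carrier W" for x w
    unfolding tensor_lift3_def by (rule tensor_lift_pt[OF uv vs(3,4) b' that])
  show "tensor_lift3 K Z f (pt K (U \<boxtimes> V) W (pt K U V u v) w) = f u v w"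
    if "u \<in> carrier U" "v \<in> carrier V" "w \<in> carrier W"
    using that by (simp add: * pt_closed vs tensor_lift_pt[OF vs(1,2,4) b])
qed

lemma tensor_lift4:
  assumes vs: "vectorspace K U" "vectorspace K V" "vectorspace K W" "vectorspace K X" "vectorspace K Z"
    and f1: "\<And>v w x. \<lbrakk>v \<in> carrier V; w \<in> carrier W; x \<in> carrier X\<rbrakk> \<Longrightarrow>
      (\<lambda>u. f u v w x) \<in> module_hom K U Z"
    and f2: "\<And>u w x. \<lbrakk>u \<in> carrier U; w \<in> carrier W; x \<in> carrier X\<rbrakk> \<Longrightarrow>
      (\<lambda>v. f u v w x) \<in> module_hom K V Z"
    and f3: "\<And>u v x. \<lbrakk>u \<in> carrier U; v \<in> carrier V; x \<in> carrier X\<rbrakk> \<Longrightarrow>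
      (\<lambda>w. f u v w x) \<in> module_hom K W Z"
    and f4: "\<And>u v w. \<lbrakk>u \<in> carrier U; v \<in> carrier V; w \<in> carrier W\<rbrakk> \<Longrightarrow>
      (\<lambda>x. f u v w x) \<in> module_hom K X Z"
  shows "tensor_lift4 K Z f \<in> module_hom K ((U \<boxtimes> V) \<boxtimes> (W \<boxtimes> X)) Z"
    and "\<lbrakk>u \<in> carrier U; v \<in> carrier V; w \<in> carrier W; x \<in> carrier X\<rbrakk> \<Longrightarrow>
      tensor_lift4 K Z f (pt K (U \<boxtimes> V) (W \<boxtimes> X) (pt K U V u v) (pt K W X w x)) = f u v w x"
proof -
  have uv: "vectorspace K (U \<boxtimes> V)" "vectorspace K (W \<boxtimes> X)" using vs by (auto intro: tensor_vectorspace)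
  have b: "bilinear_map K W X Z (\<lambda>w x. f u v w x)" if "u \<in> carrier U" "v \<in> carrier V" for u v
    using that by (intro bilinear_mapI f3 f4)
  have b': "bilinear_map K U V Z (\<lambda>u v. tensor_lift K Z (\<lambda>w x. f u v w x) y)"
    if "y \<in> carrier (W \<boxtimes> X)" for y
    using that by (intro bilinear_mapI hom_lift_parameter[where V = W and W = X] vs b f1 f2)
  have b'': "bilinear_map K (U \<boxtimes> V) (W \<boxtimes> X) Z
      (\<lambda>z y. tensor_lift K Z (\<lambda>u v. tensor_lift K Z (\<lambda>w x. f u v w x) y) z)"
    by (intro bilinear_mapI hom_lift_parameter[where V = U and W = V]
        hom_lift[where V = U and W = V] hom_lift[where V = W and W = X] vs b b' uv hom_ident)
  show "tensor_lift4 K Z f \<in> module_hom K ((U \<boxtimes> V) \<boxtimes> (W \<boxtimes> X)) Z"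
    unfolding tensor_lift4_def by (rule tensor_lift_hom[OF uv vs(5) b''])
  show "tensor_lift4 K Z f (pt K (U \<boxtimes> V) (W \<boxtimes> X) (pt K U V u v) (pt K W X w x)) = f u v w x"
    if "u \<in> carrier U" "v \<in> carrier V" "w \<in> carrier W" "x \<in> carrier X"
    unfolding tensor_lift4_def
    using that by (simp add: tensor_lift_pt[OF uv vs(5) b''] tensor_lift_pt[OF vs(1,2,5) b']
        tensor_lift_pt[OF vs(3,4,5) b] pt_closed vs)
qed

section \<open>Associators and equality of linear maps on pure tensors\<close>

lemma tassoc:
  assumes vs: "vectorspace K U" "vectorspace K V" "vectorspace K W"
  shows "tassoc K U V W \<in> module_hom K ((U \<boxtimes> V) \<boxtimes> W) (U \<boxtimes> (V \<boxtimes> W))"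
    and "\<lbrakk>u \<in> carrier U; v \<in> carrier V; w \<in> carrier W\<rbrakk> \<Longrightarrow>
      tassoc K U V W (pt K (U \<boxtimes> V) W (pt K U V u v) w) = pt K U (V \<boxtimes> W) u (pt K V W v w)"
  unfolding tassoc_def
  by (intro tensor_lift3 vs tensor_vectorspace hom_pt_left hom_pt_right pt_closed hom_ident; assumption)+

lemma tassoc_inv:
  assumes vs: "vectorspace K U" "vectorspace K V" "vectorspace K W"
  shows "tassoc_inv K U V W \<in> module_hom K (U \<boxtimes> (V \<boxtimes> W)) ((U \<boxtimes> V) \<boxtimes> W)"
    and "\<lbrakk>u \<in> carrier U; v \<in> carrier V; w \<in> carrier W\<rbrakk> \<Longrightarrow>
      tassoc_inv K U V W (pt K U (V \<boxtimes> W) u (pt K V W v w)) = pt K (U \<boxtimes> V) W (pt K U V u v) w"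
proof -
  let ?Z = "(U \<boxtimes> V) \<boxtimes> W"
  have ts: "vectorspace K (U \<boxtimes> V)" "vectorspace K (V \<boxtimes> W)" "vectorspace K ?Z"
    using vs by (auto intro!: tensor_vectorspace)
  have b: "bilinear_map K V W ?Z (\<lambda>v w. pt K (U \<boxtimes> V) W (pt K U V u v) w)" if "u \<in> carrier U" for u
    using that by (intro bilinear_mapI hom_pt_left hom_pt_right pt_closed hom_ident vs ts)
  have b': "bilinear_map K U (V \<boxtimes> W) ?Z
      (\<lambda>u. tensor_lift K ?Z (\<lambda>v w. pt K (U \<boxtimes> V) W (pt K U V u v) w))"
    by (intro bilinear_mapI hom_lift_parameter[where V = V and W = W]
        hom_lift[where V = V and W = W] b hom_pt_left pt_closed hom_ident vs ts)
  show "tassoc_inv K U V W \<in> module_hom K (U \<boxtimes> (V \<boxtimes> W)) ?Z"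
    unfolding tassoc_inv_def by (rule tensor_lift_hom[OF vs(1) ts(2,3) b'])
  show "tassoc_inv K U V W (pt K U (V \<boxtimes> W) u (pt K V W v w)) = pt K (U \<boxtimes> V) W (pt K U V u v) w"
    if "u \<in> carrier U" "v \<in> carrier V" "w \<in> carrier W"
    unfolding tassoc_inv_def
    using that by (simp add: tensor_lift_pt[OF vs(1) ts(2,3) b'] tensor_lift_pt[OF vs(2,3) ts(3) b]
        pt_closed vs)
qed

lemma tensor_hom_ext3:
  assumes vs: "vectorspace K U" "vectorspace K V" "vectorspace K W" "vectorspace K Z"
    and g: "g \<in> module_hom K ((U \<boxtimes> V) \<boxtimes> W) Z" and h: "h \<in> module_hom K ((U \<boxtimes> V) \<boxtimes> W) Z"
    and eq: "\<And>u v w. \<lbrakk>u \<in> carrier U; v \<in> carrier V; w \<in> carrier W\<rbrakk> \<Longrightarrow>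
      g (pt K (U \<boxtimes> V) W (pt K U V u v) w) = h (pt K (U \<boxtimes> V) W (pt K U V u v) w)"
    and x: "x \<in> carrier ((U \<boxtimes> V) \<boxtimes> W)"
  shows "g x = h x"
proof (rule tensor_hom_ext[OF _ vs(3,4) g h _ x])
  show uv: "vectorspace K (U \<boxtimes> V)" using vs by (intro tensor_vectorspace)
  fix y w assume w: "w \<in> carrier W" and y: "y \<in> carrier (U \<boxtimes> V)"
  show "g (pt K (U \<boxtimes> V) W y w) = h (pt K (U \<boxtimes> V) W y w)"
    by (rule tensor_hom_ext[OF vs(1,2,4) _ _ _ y])
      (use w in \<open>auto intro!: hom_compose[OF g] hom_compose[OF h] hom_pt_left hom_ident vs uv eq\<close>)
qed

text \<open>\<open>act23\<close> ends with \<open>tassoc_inv\<close>; this composite cancels it when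
  a map on the right-bracketed product follows. It must hold for all tensors, since the right-hand
  factor produced by \<open>T\<close> need not be pure.\<close>

lemma tassoc_tassoc_inv:
  assumes vs: "vectorspace K U" "vectorspace K V" "vectorspace K W"
    and x: "x \<in> carrier (U \<boxtimes> (V \<boxtimes> W))"
  shows "tassoc K U V W (tassoc_inv K U V W x) = x"
proof (rule tensor_hom_ext[OF vs(1) _ _ _ _ _ x])
  show vw: "vectorspace K (V \<boxtimes> W)" using vs by (intro tensor_vectorspace)
  show uvw: "vectorspace K (U \<boxtimes> (V \<boxtimes> W))" using vs vw by (intro tensor_vectorspace)
  show 1: "(\<lambda>x. tassoc K U V W (tassoc_inv K U V W x)) \<in> module_hom K (U \<boxtimes> (V \<boxtimes> W)) (U \<boxtimes> (V \<boxtimes> W))"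
    by (rule hom_compose[OF tassoc(1)[OF vs] tassoc_inv(1)[OF vs]])
  show "(\<lambda>x. x) \<in> module_hom K (U \<boxtimes> (V \<boxtimes> W)) (U \<boxtimes> (V \<boxtimes> W))" by (rule hom_ident)
  fix u y assume u: "u \<in> carrier U" and y: "y \<in> carrier (V \<boxtimes> W)"
  show "tassoc K U V W (tassoc_inv K U V W (pt K U (V \<boxtimes> W) u y)) = pt K U (V \<boxtimes> W) u y"
    by (rule tensor_hom_ext[OF vs(2,3) uvw _ _ _ y])
      (use u in \<open>auto intro!: hom_compose[OF 1] hom_pt_right hom_ident vs vw
        simp: tassoc(2)[OF vs] tassoc_inv(2)[OF vs]\<close>)
qed

lemma tensor_hom_ext4:
  assumes vs: "vectorspace K U" "vectorspace K V" "vectorspace K W" "vectorspace K X" "vectorspace K Z"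
    and g: "g \<in> module_hom K ((U \<boxtimes> V) \<boxtimes> (W \<boxtimes> X)) Z"
    and h: "h \<in> module_hom K ((U \<boxtimes> V) \<boxtimes> (W \<boxtimes> X)) Z"
    and eq: "\<And>u v w x. \<lbrakk>u \<in> carrier U; v \<in> carrier V; w \<in> carrier W; x \<in> carrier X\<rbrakk> \<Longrightarrow>
      g (pt K (U \<boxtimes> V) (W \<boxtimes> X) (pt K U V u v) (pt K W X w x)) =
      h (pt K (U \<boxtimes> V) (W \<boxtimes> X) (pt K U V u v) (pt K W X w x))"
    and y: "y \<in> carrier ((U \<boxtimes> V) \<boxtimes> (W \<boxtimes> X))"
  shows "g y = h y"
proof (rule tensor_hom_ext3[OF vs(1,2) _ vs(5) g h _ y])
  have uv: "vectorspace K (U \<boxtimes> V)" using vs by (intro tensor_vectorspace)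
  show wx: "vectorspace K (W \<boxtimes> X)" using vs by (intro tensor_vectorspace)
  fix u v z assume uvz: "u \<in> carrier U" "v \<in> carrier V" and z: "z \<in> carrier (W \<boxtimes> X)"
  show "g (pt K (U \<boxtimes> V) (W \<boxtimes> X) (pt K U V u v) z) = h (pt K (U \<boxtimes> V) (W \<boxtimes> X) (pt K U V u v) z)"
    by (rule tensor_hom_ext[OF vs(3,4,5) _ _ _ z])
      (use uvz in \<open>auto intro!: hom_compose[OF g] hom_compose[OF h] hom_pt_right hom_ident pt_closed vs uv wx eq\<close>)
qed

text \<open>With \<open>U = W = Y = A\<close> and \<open>V = X = Y' = B\<close> this is the
  bracketing of \<open>(D \<boxtimes> D) \<boxtimes> D\<close> for
  \<open>D = A \<boxtimes> B\<close>. The fourfold version is used twice: once with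
  \<open>U \<boxtimes> V\<close> and \<open>W \<boxtimes> X\<close> as single factors, then on these
  two with the last factors held fixed.\<close>

lemma tensor_hom_ext6:
  assumes vs: "vectorspace K U" "vectorspace K V" "vectorspace K W" "vectorspace K X"
      "vectorspace K Y" "vectorspace K Y'" "vectorspace K Z"
    and g: "g \<in> module_hom K (((U \<boxtimes> V) \<boxtimes> (W \<boxtimes> X)) \<boxtimes> (Y \<boxtimes> Y')) Z"
    and h: "h \<in> module_hom K (((U \<boxtimes> V) \<boxtimes> (W \<boxtimes> X)) \<boxtimes> (Y \<boxtimes> Y')) Z"
    and eq: "\<And>u v w x y y'. \<lbrakk>u \<in> carrier U; v \<in> carrier V; w \<in> carrier W; x \<in> carrier X;
        y \<in> carrier Y; y' \<in> carrier Y'\<rbrakk> \<Longrightarrow>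
      g (pt K ((U \<boxtimes> V) \<boxtimes> (W \<boxtimes> X)) (Y \<boxtimes> Y')
        (pt K (U \<boxtimes> V) (W \<boxtimes> X) (pt K U V u v) (pt K W X w x)) (pt K Y Y' y y')) =
      h (pt K ((U \<boxtimes> V) \<boxtimes> (W \<boxtimes> X)) (Y \<boxtimes> Y')
        (pt K (U \<boxtimes> V) (W \<boxtimes> X) (pt K U V u v) (pt K W X w x)) (pt K Y Y' y y'))"
    and \<xi>: "\<xi> \<in> carrier (((U \<boxtimes> V) \<boxtimes> (W \<boxtimes> X)) \<boxtimes> (Y \<boxtimes> Y'))"
  shows "g \<xi> = h \<xi>"
proof (rule tensor_hom_ext4[OF _ _ vs(5,6,7) g h _ \<xi>])
  show uv: "vectorspace K (U \<boxtimes> V)" and wx: "vectorspace K (W \<boxtimes> X)"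
    using vs by (auto intro: tensor_vectorspace)
  have uvwx: "vectorspace K ((U \<boxtimes> V) \<boxtimes> (W \<boxtimes> X))" and yy: "vectorspace K (Y \<boxtimes> Y')"
    using vs uv wx by (auto intro: tensor_vectorspace)
  fix p q y y' assume p: "p \<in> carrier (U \<boxtimes> V)" "q \<in> carrier (W \<boxtimes> X)"
    and y: "y \<in> carrier Y" "y' \<in> carrier Y'"
  let ?i = "\<lambda>z. pt K ((U \<boxtimes> V) \<boxtimes> (W \<boxtimes> X)) (Y \<boxtimes> Y') z (pt K Y Y' y y')"
  have i: "?i \<in> module_hom K ((U \<boxtimes> V) \<boxtimes> (W \<boxtimes> X)) (((U \<boxtimes> V) \<boxtimes> (W \<boxtimes> X)) \<boxtimes> (Y \<boxtimes> Y'))"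
    using y by (intro hom_pt_left hom_ident pt_closed uvwx yy vs)
  show "g (?i (pt K (U \<boxtimes> V) (W \<boxtimes> X) p q)) = h (?i (pt K (U \<boxtimes> V) (W \<boxtimes> X) p q))"
    by (rule tensor_hom_ext4[OF vs(1-4,7) hom_compose[OF g i] hom_compose[OF h i]])
      (use y p in \<open>auto intro!: eq pt_closed uv wx\<close>)
qed

end

section \<open>Algebras from tensor products and pseudotwistors\<close>

context bihom_assoc_algebra
begin

lemma mu_closed: "a \<in> carrier A \<Longrightarrow> a' \<in> carrier A \<Longrightarrow> \<mu> (pt K A A a a') \<in> carrier A"
  by (rule hom_closed[OF mu_linear pt_closed]) (rule vectorspace_axioms | assumption)+

lemma alpha_closed: "a \<in> carrier A \<Longrightarrow> \<alpha> a \<in> carrier A"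
  by (rule hom_closed[OF alpha_linear])

lemma beta_closed: "a \<in> carrier A \<Longrightarrow> \<beta> a \<in> carrier A"
  by (rule hom_closed[OF beta_linear])

text \<open>Multiplicativity is assumed on pure tensors only, whereas the twisted product applies
  \<open>\<mu>\<close> to values of \<open>T\<close>, which are arbitrary tensors.
  \<open>beta_mu\<close> and \<open>mu_assoc\<close> extend the other axioms for the same
  purpose.\<close>

lemma alpha_mu:
  assumes "x \<in> carrier (A \<boxtimes>\<^bsub>K\<^esub> A)" shows "\<alpha> (\<mu> x) = \<mu> (tensor_map K A A \<alpha> \<alpha> x)"
  by (rule tensor_hom_ext[OF vectorspace_axioms vectorspace_axioms vectorspace_axioms _ _ _ assms])
    (auto intro!: hom_compose[OF alpha_linear] hom_compose[OF mu_linear] mu_linear alpha_linear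
      tensor_map_hom vectorspace_axioms simp: alpha_mult
      tensor_map_pt[OF vectorspace_axioms vectorspace_axioms vectorspace_axioms vectorspace_axioms
        alpha_linear alpha_linear])

lemma beta_mu:
  assumes "x \<in> carrier (A \<boxtimes>\<^bsub>K\<^esub> A)" shows "\<beta> (\<mu> x) = \<mu> (tensor_map K A A \<beta> \<beta> x)"
  by (rule tensor_hom_ext[OF vectorspace_axioms vectorspace_axioms vectorspace_axioms _ _ _ assms])
    (auto intro!: hom_compose[OF beta_linear] hom_compose[OF mu_linear] mu_linear beta_linear
      tensor_map_hom vectorspace_axioms simp: beta_mult
      tensor_map_pt[OF vectorspace_axioms vectorspace_axioms vectorspace_axioms vectorspace_axioms
        beta_linear beta_linear])

lemma mu_assoc:
  assumes x: "x \<in> carrier ((A \<boxtimes>\<^bsub>K\<^esub> A) \<boxtimes>\<^bsub>K\<^esub> A)"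
  shows "\<mu> (tensor_map K A A \<alpha> \<mu> (tassoc K A A A x)) = \<mu> (tensor_map K A A \<mu> \<beta> x)"
proof -
  note V = vectorspace_axioms
  note VV = tensor_vectorspace[OF V V]
  have l: "tensor_map K A A \<alpha> \<mu> \<in> module_hom K (A \<boxtimes>\<^bsub>K\<^esub> (A \<boxtimes>\<^bsub>K\<^esub> A)) (A \<boxtimes>\<^bsub>K\<^esub> A)"
    by (rule tensor_map_hom[OF V VV V V alpha_linear mu_linear])
  have r: "tensor_map K A A \<mu> \<beta> \<in> module_hom K ((A \<boxtimes>\<^bsub>K\<^esub> A) \<boxtimes>\<^bsub>K\<^esub> A) (A \<boxtimes>\<^bsub>K\<^esub> A)"
    by (rule tensor_map_hom[OF VV V V V mu_linear beta_linear])
  show ?thesis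
    by (rule tensor_hom_ext3[OF V V V V _ _ _ x])
      (auto intro!: hom_compose[OF mu_linear] hom_compose[OF l] r tassoc V
        simp: tassoc[OF V V V] tensor_map_pt[OF V VV V V alpha_linear mu_linear]
          tensor_map_pt[OF VV V V V mu_linear beta_linear] pt_closed V bihom_assoc)
qed

end

text \<open>Bracketed to the right, the twisted product of three factors is \<mu> T (\<alpha>
  \<otimes> \<mu>)(id \<otimes> T). Moving T inwards gives \<mu> (\<alpha> \<otimes> \<mu>) after
  the left side of the compatibility axiom; associativity of \<mu> and compatibility change this to
  \<mu> (\<mu> \<otimes> \<beta>) after the right side, and moving T back out yields the product
  bracketed to the left.\<close>

lemma (in bihom_pseudotwistor) twisted_algebra: "bihom_assoc_algebra K D (\<mu> \<circ> T) \<alpha> \<beta>"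
proof -
  note V = vectorspace_axioms
  note VV = tensor_vectorspace[OF V V]
  note T = T_linear
  note idh = hom_id[of K D]
  have T_closed: "T (pt K D D x y) \<in> carrier (D \<boxtimes>\<^bsub>K\<^esub> D)" if "x \<in> carrier D" "y \<in> carrier D" for x y
    by (rule hom_closed[OF T pt_closed[OF V V that]])
  have \<mu>T: "\<mu> \<circ> T \<in> module_hom K (D \<boxtimes>\<^bsub>K\<^esub> D) D" by (rule hom_comp[OF mu_linear T])
  have act12: "act12 K D T \<in> module_hom K ((D \<boxtimes>\<^bsub>K\<^esub> D) \<boxtimes>\<^bsub>K\<^esub> D) ((D \<boxtimes>\<^bsub>K\<^esub> D) \<boxtimes>\<^bsub>K\<^esub> D)"
    unfolding act12_def by (intro tensor_map_hom VV V T idh)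
  have right: "tensor_map K D (D \<boxtimes>\<^bsub>K\<^esub> D) id T \<in>
      module_hom K (D \<boxtimes>\<^bsub>K\<^esub> (D \<boxtimes>\<^bsub>K\<^esub> D)) (D \<boxtimes>\<^bsub>K\<^esub> (D \<boxtimes>\<^bsub>K\<^esub> D))"
    by (intro tensor_map_hom VV V T idh)
  have act23: "act23 K D T \<in> module_hom K ((D \<boxtimes>\<^bsub>K\<^esub> D) \<boxtimes>\<^bsub>K\<^esub> D) ((D \<boxtimes>\<^bsub>K\<^esub> D) \<boxtimes>\<^bsub>K\<^esub> D)"
    unfolding act23_def
    by (rule hom_comp[OF hom_comp[OF tassoc_inv(1)[OF V V V] right] tassoc(1)[OF V V V]])
  show ?thesis
  proof
    show "\<mu> \<circ> T \<in> module_hom K (D \<boxtimes>\<^bsub>K\<^esub> D) D" by fact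
    show "\<alpha> ((\<mu> \<circ> T) (pt K D D a a')) = (\<mu> \<circ> T) (pt K D D (\<alpha> a) (\<alpha> a'))"
      if "a \<in> carrier D" "a' \<in> carrier D" for a a'
      using T_alpha[OF pt_closed[OF V V that]] that
      by (simp add: alpha_mu T_closed tensor_map_pt[OF V V V V alpha_linear alpha_linear])
    show "\<beta> ((\<mu> \<circ> T) (pt K D D a a')) = (\<mu> \<circ> T) (pt K D D (\<beta> a) (\<beta> a'))"
      if "a \<in> carrier D" "a' \<in> carrier D" for a a'
      using T_beta[OF pt_closed[OF V V that]] that
      by (simp add: beta_mu T_closed tensor_map_pt[OF V V V V beta_linear beta_linear])
    fix x y z assume xyz: "x \<in> carrier D" "y \<in> carrier D" "z \<in> carrier D"
    define \<xi> where "\<xi> = pt K (D \<boxtimes>\<^bsub>K\<^esub> D) D (pt K D D x y) z"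
    have \<xi>: "\<xi> \<in> carrier ((D \<boxtimes>\<^bsub>K\<^esub> D) \<boxtimes>\<^bsub>K\<^esub> D)" unfolding \<xi>_def by (intro pt_closed V VV xyz)
    have \<xi>12: "act12 K D T \<xi> = pt K (D \<boxtimes>\<^bsub>K\<^esub> D) D (T (pt K D D x y)) z"
      unfolding \<xi>_def act12_def using xyz
      by (simp add: tensor_map_pt[OF VV V VV V T idh] pt_closed V)
    have \<xi>23: "tassoc K D D D (act23 K D T \<xi>) = pt K D (D \<boxtimes>\<^bsub>K\<^esub> D) x (T (pt K D D y z))"
      unfolding \<xi>_def act23_def using xyz
      by (simp add: tassoc[OF V V V] tensor_map_pt[OF V VV V VV idh T] pt_closed V VV
          tassoc_tassoc_inv[OF V V V] T_closed)
    have "(\<mu> \<circ> T) (pt K D D (\<alpha> x) ((\<mu> \<circ> T) (pt K D D y z))) =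
        \<mu> ((T \<circ> tensor_map K D D \<alpha> \<mu> \<circ> tassoc K D D D) (act23 K D T \<xi>))"
      using xyz by (simp add: \<xi>23 tensor_map_pt[OF V VV V V alpha_linear mu_linear] T_closed)
    \<comment> \<open>The axiom is applied at \<open>act23 K D T \<xi>\<close>, not at
      \<open>\<xi>\<close>; this produces exactly the composite that occurs in
      \<open>T_compat\<close>.\<close>
    also have "\<dots> = \<mu> (tensor_map K D D \<alpha> \<mu> (tassoc K D D D ((T\<^sub>1 \<circ> act12 K D T \<circ> act23 K D T) \<xi>)))"
      by (subst T_mult_right) (auto intro: hom_closed[OF act23] \<xi>)
    also have "\<dots> = \<mu> (tensor_map K D D \<mu> \<beta> ((T\<^sub>2 \<circ> act23 K D T \<circ> act12 K D T) \<xi>))"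
      by (subst T_compat[OF \<xi>], rule mu_assoc)
        (auto intro!: hom_closed[OF T2_linear] hom_closed[OF act23] hom_closed[OF act12] \<xi>)
    also have "\<dots> = \<mu> ((T \<circ> tensor_map K D D \<mu> \<beta>) (act12 K D T \<xi>))"
      by (subst T_mult_left) (auto intro: hom_closed[OF act12] \<xi>)
    also have "\<dots> = (\<mu> \<circ> T) (pt K D D ((\<mu> \<circ> T) (pt K D D x y)) (\<beta> z))"
      using xyz by (simp add: \<xi>12 tensor_map_pt[OF VV V V V mu_linear beta_linear] T_closed)
    finally show "(\<mu> \<circ> T) (pt K D D (\<alpha> x) ((\<mu> \<circ> T) (pt K D D y z))) =
      (\<mu> \<circ> T) (pt K D D ((\<mu> \<circ> T) (pt K D D x y)) (\<beta> z))" .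
  qed (auto intro: alpha_linear beta_linear alpha_beta)
qed

section \<open>The tensor product of two BiHom-associative algebras\<close>

locale bihom_algebra_pair =
  A: bihom_assoc_algebra K A \<mu>\<^sub>A \<alpha>\<^sub>A \<beta>\<^sub>A + B: bihom_assoc_algebra K B \<mu>\<^sub>B \<alpha>\<^sub>B \<beta>\<^sub>B
  for K :: "('k, 'm) ring_scheme" (structure)
    and A :: "('k, 'a, 'n1) module_scheme" and \<mu>\<^sub>A \<alpha>\<^sub>A \<beta>\<^sub>A
    and B :: "('k, 'b, 'n2) module_scheme" and \<mu>\<^sub>B \<alpha>\<^sub>B \<beta>\<^sub>B
begin

abbreviation D where "D \<equiv> A \<boxtimes> B"
abbreviation \<mu>\<^sub>D where "\<mu>\<^sub>D \<equiv> tensor_mult K A \<mu>\<^sub>A B \<mu>\<^sub>B"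
abbreviation \<alpha>\<^sub>D where "\<alpha>\<^sub>D \<equiv> tensor_map K A B \<alpha>\<^sub>A \<alpha>\<^sub>B"
abbreviation \<beta>\<^sub>D where "\<beta>\<^sub>D \<equiv> tensor_map K A B \<beta>\<^sub>A \<beta>\<^sub>B"

lemma spaces:
  "vectorspace K A" "vectorspace K B" "vectorspace K D" "vectorspace K (D \<boxtimes> D)"
  "vectorspace K ((D \<boxtimes> D) \<boxtimes> D)"
  by (intro tensor_vectorspace A.vectorspace_axioms B.vectorspace_axioms)+

lemmas closed = A.mu_closed A.alpha_closed A.beta_closed B.mu_closed B.alpha_closed B.beta_closed

lemma alphaD_hom: "\<alpha>\<^sub>D \<in> module_hom K D D"
  by (intro tensor_map_hom spaces A.alpha_linear B.alpha_linear)

lemma betaD_hom: "\<beta>\<^sub>D \<in> module_hom K D D"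
  by (intro tensor_map_hom spaces A.beta_linear B.beta_linear)

lemmas alphaD_pt = tensor_map_pt[OF spaces(1,2,1,2) A.alpha_linear B.alpha_linear]
lemmas betaD_pt = tensor_map_pt[OF spaces(1,2,1,2) A.beta_linear B.beta_linear]

lemma muD_hom: "\<mu>\<^sub>D \<in> module_hom K (D \<boxtimes> D) D"
  and muD_pt: "\<lbrakk>a \<in> carrier A; b \<in> carrier B; a' \<in> carrier A; b' \<in> carrier B\<rbrakk> \<Longrightarrow>
    \<mu>\<^sub>D (pt K D D (pt K A B a b) (pt K A B a' b')) =
    pt K A B (\<mu>\<^sub>A (pt K A A a a')) (\<mu>\<^sub>B (pt K B B b b'))"
  unfolding tensor_mult_def
  by (intro tensor_lift4 spaces hom_pt_left hom_pt_right hom_compose[OF A.mu_linear]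
      hom_compose[OF B.mu_linear] hom_ident closed; assumption)+

lemma tensor_algebra: "bihom_assoc_algebra K D \<mu>\<^sub>D \<alpha>\<^sub>D \<beta>\<^sub>D"
proof (intro bihom_assoc_algebra.intro bihom_assoc_algebra_axioms.intro spaces muD_hom alphaD_hom betaD_hom)
  fix x assume x: "x \<in> carrier D"
  show "\<alpha>\<^sub>D (\<beta>\<^sub>D x) = \<beta>\<^sub>D (\<alpha>\<^sub>D x)"
    by (rule tensor_hom_ext[OF spaces(1,2,3) _ _ _ x])
      (auto intro!: hom_compose[OF alphaD_hom] hom_compose[OF betaD_hom] alphaD_hom betaD_hom
        simp: alphaD_pt betaD_pt closed A.alpha_beta B.alpha_beta)
next
  fix x y assume xy: "x \<in> carrier D" "y \<in> carrier D"
  note aa = tensor_map_hom[OF spaces(3,3,3,3) alphaD_hom alphaD_hom]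
  note bb = tensor_map_hom[OF spaces(3,3,3,3) betaD_hom betaD_hom]
  note aa_pt = tensor_map_pt[OF spaces(3,3,3,3) alphaD_hom alphaD_hom]
  note bb_pt = tensor_map_pt[OF spaces(3,3,3,3) betaD_hom betaD_hom]
  note pts = alphaD_pt betaD_pt muD_pt aa_pt bb_pt pt_closed spaces closed A.alpha_mult
    B.alpha_mult A.beta_mult B.beta_mult
  have xy': "pt K D D x y \<in> carrier (D \<boxtimes> D)" by (intro pt_closed spaces xy)
  \<comment> \<open>Here \<open>x\<close> and \<open>y\<close> are arbitrary in \<open>D\<close>.
    Writing the right-hand side as a linear function of \<open>pt K D D x y\<close> makes the
    reduction to four elements of \<open>A\<close> and \<open>B\<close> possible.\<close>
  have "\<alpha>\<^sub>D (\<mu>\<^sub>D (pt K D D x y)) = \<mu>\<^sub>D (tensor_map K D D \<alpha>\<^sub>D \<alpha>\<^sub>D (pt K D D x y))"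
    by (rule tensor_hom_ext4[OF spaces(1,2,1,2,3) hom_compose[OF alphaD_hom muD_hom]
          hom_compose[OF muD_hom aa] _ xy']) (simp add: pts)
  then show "\<alpha>\<^sub>D (\<mu>\<^sub>D (pt K D D x y)) = \<mu>\<^sub>D (pt K D D (\<alpha>\<^sub>D x) (\<alpha>\<^sub>D y))"
    by (simp add: aa_pt xy)
  have "\<beta>\<^sub>D (\<mu>\<^sub>D (pt K D D x y)) = \<mu>\<^sub>D (tensor_map K D D \<beta>\<^sub>D \<beta>\<^sub>D (pt K D D x y))"
    by (rule tensor_hom_ext4[OF spaces(1,2,1,2,3) hom_compose[OF betaD_hom muD_hom]
          hom_compose[OF muD_hom bb] _ xy']) (simp add: pts)
  then show "\<beta>\<^sub>D (\<mu>\<^sub>D (pt K D D x y)) = \<mu>\<^sub>D (pt K D D (\<beta>\<^sub>D x) (\<beta>\<^sub>D y))"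
    by (simp add: bb_pt xy)
  fix z assume z: "z \<in> carrier D"
  let ?\<xi> = "pt K (D \<boxtimes> D) D (pt K D D x y) z"
  have \<xi>: "?\<xi> \<in> carrier ((D \<boxtimes> D) \<boxtimes> D)" by (intro pt_closed spaces xy z)
  note am = tensor_map_hom[OF spaces(3,4,3,3) alphaD_hom muD_hom]
  note mb = tensor_map_hom[OF spaces(4,3,3,3) muD_hom betaD_hom]
  note ptt = tensor_map_pt[OF spaces(3,4,3,3) alphaD_hom muD_hom]
    tensor_map_pt[OF spaces(4,3,3,3) muD_hom betaD_hom] tassoc[OF spaces(3,3,3)]
  have "\<mu>\<^sub>D (tensor_map K D D \<alpha>\<^sub>D \<mu>\<^sub>D (tassoc K D D D ?\<xi>)) = \<mu>\<^sub>D (tensor_map K D D \<mu>\<^sub>D \<beta>\<^sub>D ?\<xi>)"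
    by (rule tensor_hom_ext6[OF spaces(1,2,1,2,1,2,3) hom_compose[OF muD_hom hom_compose[OF am tassoc(1)[OF spaces(3,3,3)]]]
          hom_compose[OF muD_hom mb] _ \<xi>])
      (simp add: ptt pts A.bihom_assoc B.bihom_assoc)
  then show "\<mu>\<^sub>D (pt K D D (\<alpha>\<^sub>D x) (\<mu>\<^sub>D (pt K D D y z))) = \<mu>\<^sub>D (pt K D D (\<mu>\<^sub>D (pt K D D x y)) (\<beta>\<^sub>D z))"
    using xy z by (simp add: ptt pt_closed spaces)
qed

end

section \<open>The pseudotwistor of a twisting map\<close>

context bihom_algebra_pair
begin

text \<open>At \<open>R (b \<otimes> a')\<close> this is the expression (a \<otimes> b_R) \<otimes>
  (a'_R \<otimes> b'). The two components of the argument cross: the B-component joins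
  \<open>a\<close>, the A-component joins \<open>b'\<close>.\<close>

abbreviation sandwich where
  "sandwich a b' \<equiv> tensor_lift K (D \<boxtimes> D) (\<lambda>x y. pt K D D (pt K A B a y) (pt K A B x b'))"

text \<open>The inner lift of \<open>act13\<close>, which puts the untouched middle factor back
  between the two components of a value of \<open>T\<close>.\<close>

abbreviation insert_middle where
  "insert_middle y \<equiv> tensor_lift K ((D \<boxtimes> D) \<boxtimes> D) (\<lambda>p q. pt K (D \<boxtimes> D) D (pt K D D p y) q)"

lemma sandwich_bilinear:
  assumes "a \<in> carrier A" "b' \<in> carrier B"
  shows "bilinear_map K A B (D \<boxtimes> D) (\<lambda>x y. pt K D D (pt K A B a y) (pt K A B x b'))"
  using assms by (intro bilinear_mapI hom_pt_left hom_pt_right hom_ident pt_closed spaces)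

lemma sandwich:
  assumes "a \<in> carrier A" "b' \<in> carrier B"
  shows "sandwich a b' \<in> module_hom K D (D \<boxtimes> D)"
    and "x \<in> carrier A \<Longrightarrow> y \<in> carrier B \<Longrightarrow>
      sandwich a b' (pt K A B x y) = pt K D D (pt K A B a y) (pt K A B x b')"
  by (rule tensor_lift_hom[OF spaces(1,2,4) sandwich_bilinear[OF assms]])
    (rule tensor_lift_pt[OF spaces(1,2,4) sandwich_bilinear[OF assms]])

lemma insert_middle_bilinear:
  assumes "y \<in> carrier D"
  shows "bilinear_map K D D ((D \<boxtimes> D) \<boxtimes> D) (\<lambda>p q. pt K (D \<boxtimes> D) D (pt K D D p y) q)"
  using assms by (intro bilinear_mapI hom_pt_left hom_pt_right hom_ident pt_closed spaces)

lemma insert_middle: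
  assumes "y \<in> carrier D"
  shows "insert_middle y \<in> module_hom K (D \<boxtimes> D) ((D \<boxtimes> D) \<boxtimes> D)"
    and "p \<in> carrier D \<Longrightarrow> q \<in> carrier D \<Longrightarrow>
      insert_middle y (pt K D D p q) = pt K (D \<boxtimes> D) D (pt K D D p y) q"
  by (rule tensor_lift_hom[OF spaces(3,3,5) insert_middle_bilinear[OF assms]])
    (rule tensor_lift_pt[OF spaces(3,3,5) insert_middle_bilinear[OF assms]])

lemma act13:
  assumes T: "T \<in> module_hom K (D \<boxtimes> D) (D \<boxtimes> D)"
  shows "act13 K D T \<in> module_hom K ((D \<boxtimes> D) \<boxtimes> D) ((D \<boxtimes> D) \<boxtimes> D)"
    and "\<lbrakk>x \<in> carrier D; y \<in> carrier D; z \<in> carrier D\<rbrakk> \<Longrightarrow>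
      act13 K D T (pt K (D \<boxtimes> D) D (pt K D D x y) z) = insert_middle y (T (pt K D D x z))"
  unfolding act13_def
  by (intro tensor_lift3 spaces hom_lift[OF spaces(3,3,5)] hom_lift_parameter[OF spaces(3,3,5)]
      hom_compose[OF T] hom_closed[OF T] insert_middle_bilinear hom_pt_left hom_pt_right hom_ident
      pt_closed; assumption)+

lemma act12:
  assumes T: "T \<in> module_hom K (D \<boxtimes> D) (D \<boxtimes> D)"
  shows "act12 K D T \<in> module_hom K ((D \<boxtimes> D) \<boxtimes> D) ((D \<boxtimes> D) \<boxtimes> D)"
    and "\<lbrakk>x \<in> carrier (D \<boxtimes> D); z \<in> carrier D\<rbrakk> \<Longrightarrow>
      act12 K D T (pt K (D \<boxtimes> D) D x z) = pt K (D \<boxtimes> D) D (T x) z"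
  unfolding act12_def
  by (rule tensor_map_hom[OF spaces(4,3,4,3) T hom_id])
    (simp add: tensor_map_pt[OF spaces(4,3,4,3) T hom_id])

lemma act23:
  assumes T: "T \<in> module_hom K (D \<boxtimes> D) (D \<boxtimes> D)"
  shows "act23 K D T \<in> module_hom K ((D \<boxtimes> D) \<boxtimes> D) ((D \<boxtimes> D) \<boxtimes> D)"
    and "\<lbrakk>x \<in> carrier D; y \<in> carrier D; z \<in> carrier D\<rbrakk> \<Longrightarrow>
      act23 K D T (pt K (D \<boxtimes> D) D (pt K D D x y) z) =
      tassoc_inv K D D D (pt K D (D \<boxtimes> D) x (T (pt K D D y z)))"
  unfolding act23_def
  by (rule hom_comp[OF hom_comp[OF tassoc_inv(1)[OF spaces(3,3,3)]
      tensor_map_hom[OF spaces(3,4,3,4) hom_id T]] tassoc(1)[OF spaces(3,3,3)]])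
    (simp add: tassoc[OF spaces(3,3,3)] tensor_map_pt[OF spaces(3,4,3,4) hom_id T] pt_closed spaces)

text \<open>With the structure maps for \<open>f\<close> and \<open>g\<close>, this reduces the
  commutation of \<open>T\<close> with \<open>\<alpha>\<^sub>D\<close> and
  \<open>\<beta>\<^sub>D\<close> to that of \<open>R\<close>.\<close>

lemma tensor_map_sandwich:
  assumes f: "f \<in> module_hom K A A" and g: "g \<in> module_hom K B B"
    and ab: "a \<in> carrier A" "b' \<in> carrier B" and x: "x \<in> carrier D"
  shows "tensor_map K D D (tensor_map K A B f g) (tensor_map K A B f g) (sandwich a b' x) =
    sandwich (f a) (g b') (tensor_map K A B f g x)"
proof -
  note fg = tensor_map_hom[OF spaces(1,2,1,2) f g]
  note fgfg = tensor_map_hom[OF spaces(3,3,3,3) fg fg]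
  note ab' = hom_closed[OF f ab(1)] hom_closed[OF g ab(2)]
  show ?thesis
    by (rule tensor_hom_ext[OF spaces(1,2,4) hom_compose[OF fgfg sandwich(1)[OF ab]]
          hom_compose[OF sandwich(1)[OF ab'] fg] _ x])
      (simp add: tensor_map_pt[OF spaces(1,2,1,2) f g] tensor_map_pt[OF spaces(3,3,3,3) fg fg]
        sandwich(2) ab ab' hom_closed[OF f] hom_closed[OF g] pt_closed spaces)
qed

text \<open>The conjugating maps of both companions have this shape, acting on the first B-slot and
  the last A-slot. The factors \<open>tensor_map K A B id id\<close> are left uncollapsed so that
  the companions of the theorem are instances by mere unfolding.\<close>

abbreviation outer where
  "outer f g \<equiv> tensor_map K (D \<boxtimes> D) D
    (tensor_map K D D (tensor_map K A B id f) (tensor_map K A B id id)) (tensor_map K A B g id)"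

lemma outer_hom:
  assumes f: "f \<in> module_hom K B B" and g: "g \<in> module_hom K A A"
  shows "outer f g \<in> module_hom K ((D \<boxtimes> D) \<boxtimes> D) ((D \<boxtimes> D) \<boxtimes> D)"
  by (intro tensor_map_hom spaces f g hom_id)

lemma outer_pt:
  assumes f: "f \<in> module_hom K B B" and g: "g \<in> module_hom K A A"
    and "a \<in> carrier A" "b \<in> carrier B" "a' \<in> carrier A" "b' \<in> carrier B" "a'' \<in> carrier A" "b'' \<in> carrier B"
  shows "outer f g (pt K (D \<boxtimes> D) D (pt K D D (pt K A B a b) (pt K A B a' b')) (pt K A B a'' b'')) =
    pt K (D \<boxtimes> D) D (pt K D D (pt K A B a (f b)) (pt K A B a' b')) (pt K A B (g a'') b'')"
  using assms(3-) by (simp add: tensor_map_pt tensor_map_hom spaces f g hom_id pt_closed)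

text \<open>\<open>sandwich\<close> places the B-component of \<open>x\<close> in the first factor
  and its A-component in the third, exactly the slots on which \<open>outer f g\<close> acts. Hence
  \<open>outer f g\<close> can be moved onto \<open>x\<close> itself.\<close>

lemma outer_insert_middle:
  assumes f: "f \<in> module_hom K B B" and g: "g \<in> module_hom K A A"
    and a: "a \<in> carrier A" "a' \<in> carrier A" and b: "b' \<in> carrier B" "b'' \<in> carrier B"
    and x: "x \<in> carrier D"
  shows "outer f g (insert_middle (pt K A B a' b') (sandwich a b'' x)) =
    insert_middle (pt K A B a' b') (sandwich a b'' (tensor_map K A B g f x))"
proof -
  have y: "pt K A B a' b' \<in> carrier D" by (intro pt_closed spaces a b)
  note i = hom_compose[OF insert_middle(1)[OF y] sandwich(1)[OF a(1) b(2)]]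
  show ?thesis
    by (rule tensor_hom_ext[OF spaces(1,2,5) hom_compose[OF outer_hom[OF f g] i]
          hom_compose[OF i tensor_map_hom[OF spaces(1,2,1,2) g f]] _ x])
      (simp add: sandwich(2) insert_middle(2) tensor_map_pt[OF spaces(1,2,1,2) g f] outer_pt f g
        a b y hom_closed[OF f] hom_closed[OF g] pt_closed spaces)
qed

end

section \<open>The twistor of a twisting map and its two companions\<close>

context bihom_twisting_map
begin

sublocale bihom_algebra_pair K A \<mu>\<^sub>A \<alpha>\<^sub>A \<beta>\<^sub>A B \<mu>\<^sub>B \<alpha>\<^sub>B \<beta>\<^sub>B
  by unfold_locales

text \<open>\<open>p\<close> and \<open>q\<close> are \<alpha> composed with the inverse of \<beta>,
  on \<open>B\<close> and on \<open>A\<close>. The primed maps are their inverses because \<alpha>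
  and \<beta> commute.\<close>

definition "p = \<alpha>\<^sub>B \<circ> inv_into (carrier B) \<beta>\<^sub>B"
definition "p' = inv_into (carrier B) \<alpha>\<^sub>B \<circ> \<beta>\<^sub>B"
definition "q = \<alpha>\<^sub>A \<circ> inv_into (carrier A) \<beta>\<^sub>A"
definition "q' = inv_into (carrier A) \<alpha>\<^sub>A \<circ> \<beta>\<^sub>A"
definition "T = twistor_of K A B R"
definition "T\<^sub>1 = outer p' id \<circ> act13 K D T \<circ> outer p id"
definition "T\<^sub>2 = outer id q \<circ> act13 K D T \<circ> outer id q'"

lemma pq_hom:
  "p \<in> module_hom K B B" "p' \<in> module_hom K B B" "q \<in> module_hom K A A" "q' \<in> module_hom K A A"
  unfolding p_def p'_def q_def q'_def
  by (rule hom_comp[OF B.alpha_linear hom_inv_into[OF spaces(2) B.beta_linear bij_betaB]]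
      hom_comp[OF hom_inv_into[OF spaces(2) B.alpha_linear bij_alphaB] B.beta_linear]
      hom_comp[OF A.alpha_linear hom_inv_into[OF spaces(1) A.beta_linear bij_betaA]]
      hom_comp[OF hom_inv_into[OF spaces(1) A.alpha_linear bij_alphaA] A.beta_linear])+

lemmas pq_closed = pq_hom[THEN hom_closed]

lemma inv_closed:
  "a \<in> carrier A \<Longrightarrow> inv_into (carrier A) \<alpha>\<^sub>A a \<in> carrier A"
  "a \<in> carrier A \<Longrightarrow> inv_into (carrier A) \<beta>\<^sub>A a \<in> carrier A"
  "b \<in> carrier B \<Longrightarrow> inv_into (carrier B) \<alpha>\<^sub>B b \<in> carrier B"
  "b \<in> carrier B \<Longrightarrow> inv_into (carrier B) \<beta>\<^sub>B b \<in> carrier B"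
  using bij_alphaA bij_alphaB bij_betaA bij_betaB by (metis bij_betw_def inv_into_into)+

lemma inv_cancel:
  "a \<in> carrier A \<Longrightarrow> \<alpha>\<^sub>A (inv_into (carrier A) \<alpha>\<^sub>A a) = a"
  "a \<in> carrier A \<Longrightarrow> \<beta>\<^sub>A (inv_into (carrier A) \<beta>\<^sub>A a) = a"
  "b \<in> carrier B \<Longrightarrow> \<alpha>\<^sub>B (inv_into (carrier B) \<alpha>\<^sub>B b) = b"
  "b \<in> carrier B \<Longrightarrow> \<beta>\<^sub>B (inv_into (carrier B) \<beta>\<^sub>B b) = b"
  "a \<in> carrier A \<Longrightarrow> inv_into (carrier A) \<alpha>\<^sub>A (\<alpha>\<^sub>A a) = a"
  "a \<in> carrier A \<Longrightarrow> inv_into (carrier A) \<beta>\<^sub>A (\<beta>\<^sub>A a) = a"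
  "b \<in> carrier B \<Longrightarrow> inv_into (carrier B) \<alpha>\<^sub>B (\<alpha>\<^sub>B b) = b"
  "b \<in> carrier B \<Longrightarrow> inv_into (carrier B) \<beta>\<^sub>B (\<beta>\<^sub>B b) = b"
  using bij_alphaA bij_alphaB bij_betaA bij_betaB
  by (simp_all add: bij_betw_inv_into_right bij_betw_inv_into_left)

text \<open>The first two equations trade the structure map of a pseudotwistor axiom for that of the
  corresponding twisting axiom. The last two serve to move \<open>p\<close> and \<open>q\<close>
  through \<open>R\<close>.\<close>

lemma pq_simps:
  "b \<in> carrier B \<Longrightarrow> \<alpha>\<^sub>B (p' b) = \<beta>\<^sub>B b" "a \<in> carrier A \<Longrightarrow> \<beta>\<^sub>A (q a) = \<alpha>\<^sub>A a"
  "b \<in> carrier B \<Longrightarrow> p (\<beta>\<^sub>B b) = \<alpha>\<^sub>B b" "a \<in> carrier A \<Longrightarrow> q (\<beta>\<^sub>A a) = \<alpha>\<^sub>A a"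
  by (simp_all add: p_def p'_def q_def inv_cancel inv_closed closed flip: A.alpha_beta)

lemma p'_p: "b \<in> carrier B \<Longrightarrow> p' (p b) = b"
  by (simp add: p_def p'_def inv_cancel inv_closed closed flip: B.alpha_beta)

text \<open>In this composite the two inverses are adjacent, so the commutation of \<alpha> and
  \<beta> does not apply directly. Both sides are compared after the injective map
  \<open>\<beta>\<^sub>A\<close> instead.\<close>

lemma q_q':
  assumes a: "a \<in> carrier A" shows "q (q' a) = a"
proof -
  have "\<beta>\<^sub>A (q (q' a)) = \<beta>\<^sub>A a" using a by (simp add: pq_simps pq_closed) (simp add: q'_def inv_cancel closed)
  then show ?thesis using bij_betaA a pq_closed by (metis inv_cancel(6))
qed

lemma R_closed: "b \<in> carrier B \<Longrightarrow> a \<in> carrier A \<Longrightarrow> R (pt K B A b a) \<in> carrier D"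
  by (rule hom_closed[OF R_linear]) (intro pt_closed spaces)

lemma R_alpha_pt:
  assumes "b \<in> carrier B" "a \<in> carrier A"
  shows "R (pt K B A (\<alpha>\<^sub>B b) (\<alpha>\<^sub>A a)) = \<alpha>\<^sub>D (R (pt K B A b a))"
  using R_alpha[of "pt K B A b a"] assms
  by (simp add: tensor_map_pt[OF spaces(2,1,2,1) B.alpha_linear A.alpha_linear] pt_closed spaces)

lemma R_beta_pt:
  assumes "b \<in> carrier B" "a \<in> carrier A"
  shows "R (pt K B A (\<beta>\<^sub>B b) (\<beta>\<^sub>A a)) = \<beta>\<^sub>D (R (pt K B A b a))"
  using R_beta[of "pt K B A b a"] assms
  by (simp add: tensor_map_pt[OF spaces(2,1,2,1) B.beta_linear A.beta_linear] pt_closed spaces)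

text \<open>Writing \<open>b\<close> and \<open>a\<close> as values of \<beta>, the maps
  \<open>p\<close> and \<open>q\<close> turn \<beta> into \<alpha> on the left, and q \<otimes> p
  turns \<beta> \<otimes> \<beta> into \<alpha> \<otimes> \<alpha> on the right. What remains is
  that \<open>R\<close> commutes with the structure maps.\<close>

lemma R_pq:
  assumes ba: "b \<in> carrier B" "a \<in> carrier A"
  shows "R (pt K B A (p b) (q a)) = tensor_map K A B q p (R (pt K B A b a))"
proof -
  define b0 a0 where "b0 = inv_into (carrier B) \<beta>\<^sub>B b" and "a0 = inv_into (carrier A) \<beta>\<^sub>A a"
  have c: "b0 \<in> carrier B" "a0 \<in> carrier A" and e: "b = \<beta>\<^sub>B b0" "a = \<beta>\<^sub>A a0"
    using ba by (simp_all add: b0_def a0_def inv_closed inv_cancel)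
  note qp = tensor_map_hom[OF spaces(1,2,1,2) pq_hom(3,1)]
  have "tensor_map K A B q p (\<beta>\<^sub>D x) = \<alpha>\<^sub>D x" if "x \<in> carrier D" for x
    by (rule tensor_hom_ext[OF spaces(1,2,3) hom_compose[OF qp betaD_hom] alphaD_hom _ that])
      (simp add: alphaD_pt betaD_pt tensor_map_pt[OF spaces(1,2,1,2) pq_hom(3,1)] closed pq_simps)
  then show ?thesis using c by (simp add: e pq_simps R_alpha_pt R_beta_pt R_closed)
qed

text \<open>Writing \<open>a = q (q' a)\<close> lets \<open>R_pq\<close> pull \<open>p\<close> and
  \<open>q\<close> out of \<open>R\<close>; then \<open>p'\<close> cancels \<open>p\<close> and only
  \<open>q\<close> survives. This one identity makes the companions equal.\<close>

lemma R_p_q':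
  assumes ba: "b \<in> carrier B" "a \<in> carrier A"
  shows "tensor_map K A B id p' (R (pt K B A (p b) a)) = tensor_map K A B q id (R (pt K B A b (q' a)))"
proof -
  note hom = tensor_map_hom[OF spaces(1,2,1,2) pq_hom(3,1)]
    tensor_map_hom[OF spaces(1,2,1,2) hom_id pq_hom(2)]
    tensor_map_hom[OF spaces(1,2,1,2) pq_hom(3) hom_id]
  have "tensor_map K A B id p' (tensor_map K A B q p x) = tensor_map K A B q id x"
    if "x \<in> carrier D" for x
    by (rule tensor_hom_ext[OF spaces(1,2,3) hom_compose[OF hom(2,1)] hom(3) _ that])
      (simp add: tensor_map_pt spaces pq_hom hom_id pq_closed p'_p)
  then show ?thesis
    using ba R_pq[of b "q' a"] by (simp add: q_q' pq_closed R_closed)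
qed

lemma T_hom: "T \<in> module_hom K (D \<boxtimes>\<^bsub>K\<^esub> D) (D \<boxtimes>\<^bsub>K\<^esub> D)"
  and T_pt: "\<lbrakk>a \<in> carrier A; b \<in> carrier B; a' \<in> carrier A; b' \<in> carrier B\<rbrakk> \<Longrightarrow>
    T (pt K D D (pt K A B a b) (pt K A B a' b')) = sandwich a b' (R (pt K B A b a'))"
  unfolding T_def twistor_of_def Let_def
  by (intro tensor_lift4 spaces hom_lift_parameter[OF spaces(1,2,4)] hom_compose[OF R_linear]
      hom_compose[OF sandwich(1)] hom_pt_left hom_pt_right hom_ident sandwich_bilinear R_closed
      pt_closed; assumption)+

lemma T12_hom:
  "T\<^sub>1 \<in> module_hom K ((D \<boxtimes>\<^bsub>K\<^esub> D) \<boxtimes>\<^bsub>K\<^esub> D) ((D \<boxtimes>\<^bsub>K\<^esub> D) \<boxtimes>\<^bsub>K\<^esub> D)"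
  "T\<^sub>2 \<in> module_hom K ((D \<boxtimes>\<^bsub>K\<^esub> D) \<boxtimes>\<^bsub>K\<^esub> D) ((D \<boxtimes>\<^bsub>K\<^esub> D) \<boxtimes>\<^bsub>K\<^esub> D)"
  unfolding T\<^sub>1_def T\<^sub>2_def
  by (rule hom_comp[OF hom_comp[OF outer_hom[OF pq_hom(2) hom_id] act13(1)[OF T_hom]] outer_hom[OF pq_hom(1) hom_id]]
      hom_comp[OF hom_comp[OF outer_hom[OF hom_id pq_hom(3)] act13(1)[OF T_hom]] outer_hom[OF hom_id pq_hom(4)]])+

text \<open>The map applied before \<open>act13\<close> changes only \<open>b\<close>, so it enters
  the argument of \<open>R\<close>; the map applied after it is carried onto the value of
  \<open>R\<close> by \<open>outer_insert_middle\<close>.\<close>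

lemma T1_pt:
  assumes "a \<in> carrier A" "b \<in> carrier B" "a' \<in> carrier A" "b' \<in> carrier B" "a'' \<in> carrier A" "b'' \<in> carrier B"
  shows "T\<^sub>1 (pt K (D \<boxtimes>\<^bsub>K\<^esub> D) D (pt K D D (pt K A B a b) (pt K A B a' b')) (pt K A B a'' b'')) =
    insert_middle (pt K A B a' b') (sandwich a b'' (tensor_map K A B id p' (R (pt K B A (p b) a''))))"
  using assms by (simp add: T\<^sub>1_def outer_pt outer_insert_middle act13(2) T_hom T_pt pq_hom hom_id
      pt_closed spaces pq_closed R_closed)

lemma T2_pt:
  assumes "a \<in> carrier A" "b \<in> carrier B" "a' \<in> carrier A" "b' \<in> carrier B" "a'' \<in> carrier A" "b'' \<in> carrier B"
  shows "T\<^sub>2 (pt K (D \<boxtimes>\<^bsub>K\<^esub> D) D (pt K D D (pt K A B a b) (pt K A B a' b')) (pt K A B a'' b'')) =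
    insert_middle (pt K A B a' b') (sandwich a b'' (tensor_map K A B q id (R (pt K B A b (q' a'')))))"
  using assms by (simp add: T\<^sub>2_def outer_pt outer_insert_middle act13(2) T_hom T_pt pq_hom hom_id
      pt_closed spaces pq_closed R_closed)

lemma T1_eq_T2: "x \<in> carrier ((D \<boxtimes>\<^bsub>K\<^esub> D) \<boxtimes>\<^bsub>K\<^esub> D) \<Longrightarrow> T\<^sub>1 x = T\<^sub>2 x"
  by (rule tensor_hom_ext6[OF spaces(1,2,1,2,1,2,5) T12_hom]) (auto simp: T1_pt T2_pt R_p_q')

text \<open>In the order a, b, a', b', a'', b'' the first map applies \<open>R\<close> to slots 2
  and 3, the second to slots 4 and 5.\<close>

lemma act12_act23_commute:
  assumes "x \<in> carrier ((D \<boxtimes>\<^bsub>K\<^esub> D) \<boxtimes>\<^bsub>K\<^esub> D)"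
  shows "act12 K D T (act23 K D T x) = act23 K D T (act12 K D T x)"
proof -
  note act = act12(1)[OF T_hom] act23(1)[OF T_hom] tassoc_inv(1)[OF spaces(3,3,3)]
  show ?thesis
  proof (rule tensor_hom_ext6[OF spaces(1,2,1,2,1,2,5) hom_compose[OF act(1,2)] hom_compose[OF act(2,1)] _ assms])
    fix a b a' b' a'' b''
    assume ab: "a \<in> carrier A" "b \<in> carrier B" "a' \<in> carrier A" "b' \<in> carrier B"
      "a'' \<in> carrier A" "b'' \<in> carrier B"
    note pts = act12(2) act23(2) T_hom T_pt pt_closed spaces R_closed tassoc_inv(2) sandwich(2)
      hom_closed[OF sandwich(1)] ab
    \<comment> \<open>For \<open>X = x \<otimes> y\<close> and \<open>Y = u \<otimes> v\<close>,
      both expressions are ((a \<otimes> v) \<otimes> (u \<otimes> y)) \<otimes> (x \<otimes> b'').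
      They differ in which of the two values is resolved first: \<open>?L\<close> lifts over
      \<open>X\<close> and keeps \<open>Y\<close> whole, as \<open>act12\<close> after
      \<open>act23\<close> does, and \<open>?R\<close> does the reverse.\<close>
    let ?l = "\<lambda>Y x y. pt K (D \<boxtimes>\<^bsub>K\<^esub> D) D (sandwich a y Y) (pt K A B x b'')"
    let ?r = "\<lambda>X u v. tassoc_inv K D D D (pt K D (D \<boxtimes>\<^bsub>K\<^esub> D) (pt K A B a v) (sandwich u b'' X))"
    let ?L = "\<lambda>X Y. tensor_lift K ((D \<boxtimes>\<^bsub>K\<^esub> D) \<boxtimes>\<^bsub>K\<^esub> D) (?l Y) X"
    let ?R = "\<lambda>X Y. tensor_lift K ((D \<boxtimes>\<^bsub>K\<^esub> D) \<boxtimes>\<^bsub>K\<^esub> D) (?r X) Y"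
    have l: "bilinear_map K A B ((D \<boxtimes>\<^bsub>K\<^esub> D) \<boxtimes>\<^bsub>K\<^esub> D) (?l Y)" if "Y \<in> carrier D" for Y
      using that ab by (intro bilinear_mapI hom_pt_left hom_pt_right hom_lift_parameter[OF spaces(1,2,4)]
        sandwich_bilinear hom_ident pt_closed spaces hom_closed[OF sandwich(1)])
    have r: "bilinear_map K A B ((D \<boxtimes>\<^bsub>K\<^esub> D) \<boxtimes>\<^bsub>K\<^esub> D) (?r X)" if "X \<in> carrier D" for X
      using that ab by (intro bilinear_mapI hom_compose[OF act(3)] hom_pt_left hom_pt_right
        hom_lift_parameter[OF spaces(1,2,4)] sandwich_bilinear hom_ident pt_closed spaces
        hom_closed[OF sandwich(1)])
    note L = tensor_lift_hom[OF spaces(1,2,5) l] tensor_lift_pt[OF spaces(1,2,5) l]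
    note R = tensor_lift_hom[OF spaces(1,2,5) r] tensor_lift_pt[OF spaces(1,2,5) r]
    have RX: "(\<lambda>X. ?R X Y) \<in> module_hom K D ((D \<boxtimes>\<^bsub>K\<^esub> D) \<boxtimes>\<^bsub>K\<^esub> D)" if "Y \<in> carrier D" for Y
      using that ab by (intro hom_lift_parameter[OF spaces(1,2,5)] r hom_compose[OF act(3)]
        hom_pt_right sandwich pt_closed spaces)
    \<comment> \<open>A change of the order of two lifts. It needs \<open>?R\<close> to be linear in
      \<open>X\<close>, which there is a parameter of the lifted map; this is the purpose of
      \<open>RX\<close>.\<close>
    have swap: "?L X Y = ?R X Y" if X: "X \<in> carrier D" and Y: "Y \<in> carrier D" for X Y
    proof (rule tensor_hom_ext[OF spaces(1,2,5) L(1)[OF Y] RX[OF Y] _ X])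
      fix x y assume xy: "x \<in> carrier A" "y \<in> carrier B"
      have xy': "pt K A B x y \<in> carrier D" by (intro pt_closed spaces xy)
      have LY: "(\<lambda>Y. ?l Y x y) \<in> module_hom K D ((D \<boxtimes>\<^bsub>K\<^esub> D) \<boxtimes>\<^bsub>K\<^esub> D)"
        using xy ab by (intro hom_pt_left sandwich pt_closed spaces)
      have "?l Y x y = ?R (pt K A B x y) Y"
        by (rule tensor_hom_ext[OF spaces(1,2,5) LY R(1)[OF xy'] _ Y])
          (simp add: R(2)[OF xy'] pts xy)
      then show "?L (pt K A B x y) Y = ?R (pt K A B x y) Y" by (simp only: L(2)[OF Y xy])
    qed
    define X Y where "X = R (pt K B A b' a'')" and "Y = R (pt K B A b a')"
    have XY: "X \<in> carrier D" "Y \<in> carrier D" using ab by (simp_all add: X_def Y_def R_closed)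
    have ab': "pt K A B a b \<in> carrier D" "pt K A B a'' b'' \<in> carrier D" by (intro pt_closed spaces ab)+
    have "act12 K D T (tassoc_inv K D D D (pt K D (D \<boxtimes>\<^bsub>K\<^esub> D) (pt K A B a b) (sandwich a' b'' X))) = ?L X Y"
      by (rule tensor_hom_ext[OF spaces(1,2,5)
            hom_compose[OF act(1) hom_compose[OF act(3) hom_pt_right[OF spaces(3,4) ab'(1) sandwich(1)]]]
            L(1)[OF XY(2)] _ XY(1)])
        (simp_all add: L(2)[OF XY(2)] pts flip: Y_def)
    moreover have "act23 K D T (pt K (D \<boxtimes>\<^bsub>K\<^esub> D) D (sandwich a b' Y) (pt K A B a'' b'')) = ?R X Y"
      by (rule tensor_hom_ext[OF spaces(1,2,5)
            hom_compose[OF act(2) hom_pt_left[OF spaces(4,3) sandwich(1) ab'(2)]]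
            R(1)[OF XY(1)] _ XY(2)])
        (simp_all add: R(2)[OF XY(1)] pts flip: X_def)
    ultimately show "act12 K D T (act23 K D T (pt K (D \<boxtimes>\<^bsub>K\<^esub> D) D (pt K D D (pt K A B a b) (pt K A B a' b')) (pt K A B a'' b'')))
      = act23 K D T (act12 K D T (pt K (D \<boxtimes>\<^bsub>K\<^esub> D) D (pt K D D (pt K A B a b) (pt K A B a' b')) (pt K A B a'' b'')))"
      using swap[OF XY] by (simp add: pts flip: X_def Y_def)
  qed
qed

text \<open>On the left \<open>R\<close> meets \<open>\<alpha>\<^sub>B b\<close> and the product of
  \<open>a'\<close> and \<open>a''\<close>. \<open>R_multA\<close> splits this into \<open>R\<close>
  at \<open>b\<close>, \<open>a'\<close> and then \<open>R\<close> at \<open>p\<close> of the new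
  B-component and \<open>a''\<close>; these are the applications of \<open>R\<close> made by
  \<open>act12\<close> and by \<open>T\<^sub>1\<close>.\<close>

lemma T_multiplication_right:
  assumes x: "x \<in> carrier ((D \<boxtimes>\<^bsub>K\<^esub> D) \<boxtimes>\<^bsub>K\<^esub> D)"
  shows "T (tensor_map K D D \<alpha>\<^sub>D \<mu>\<^sub>D (tassoc K D D D x)) =
    tensor_map K D D \<alpha>\<^sub>D \<mu>\<^sub>D (tassoc K D D D (T\<^sub>1 (act12 K D T x)))"
proof -
  note VA = spaces(1) and VB = spaces(2) and VD = spaces(3) and VDD = spaces(4)
  note BA = tensor_vectorspace[OF VB VA]
  note am = tensor_map_hom[OF VD VDD VD VD alphaD_hom muD_hom]
  note am_pt = tensor_map_pt[OF VD VDD VD VD alphaD_hom muD_hom]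
  note l = hom_compose[OF am tassoc(1)[OF VD VD VD]]
  note lT = hom_compose[OF l T12_hom(1)]
  show ?thesis
  proof (rule tensor_hom_ext6[OF VA VB VA VB VA VB VDD hom_compose[OF T_hom l]
        hom_compose[OF lT act12(1)[OF T_hom]] _ x])
    fix a b a' b' a'' b''
    assume ab: "a \<in> carrier A" "b \<in> carrier B" "a' \<in> carrier A" "b' \<in> carrier B"
      "a'' \<in> carrier A" "b'' \<in> carrier B"
    note pts = am_pt tassoc(2) alphaD_pt muD_pt T_pt act12(2) T_hom pt_closed spaces closed
      R_closed ab sandwich(2) insert_middle(2) pq_simps pq_closed tassoc_inv(2)
    \<comment> \<open>\<open>n X\<close> is the right-hand side of \<open>R_multA\<close> with \<open>X\<close> in place of \<open>R (b \<otimes> a')\<close>; on a pure tensor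
      \<open>X = x \<otimes> y\<close> it is \<open>m x Y\<close>, where \<open>Y\<close> is the value of the second application of \<open>R\<close>.\<close>
    define m where "m = (\<lambda>x Y. tensor_map K A B \<mu>\<^sub>A \<beta>\<^sub>B (tassoc_inv K A A B (pt K A D x Y)))"
    have m: "m x \<in> module_hom K D D" if "x \<in> carrier A" for x
      unfolding m_def using that
      by (intro hom_compose[OF tensor_map_hom[OF tensor_vectorspace[OF VA VA] VB VA VB A.mu_linear B.beta_linear]]
          hom_compose[OF tassoc_inv(1)[OF VA VA VB]] hom_pt_right hom_ident spaces)
    have m_pt: "m x (pt K A B u v) = pt K A B (\<mu>\<^sub>A (pt K A A x u)) (\<beta>\<^sub>B v)"
      if "x \<in> carrier A" "u \<in> carrier A" "v \<in> carrier B" for x u v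
      unfolding m_def using that
      by (simp add: tassoc_inv(2) spaces pt_closed
          tensor_map_pt[OF tensor_vectorspace[OF VA VA] VB VA VB A.mu_linear B.beta_linear])
    note s = sandwich(1)[OF closed(2)[OF ab(1)] closed(4)[OF ab(4,6)]]
    \<comment> \<open>For \<open>Y = u \<otimes> v\<close>, the map \<open>\<alpha>\<^sub>D\<close>
      on the first factor sends \<open>p' v\<close> to \<open>\<beta>\<^sub>B v\<close>, the value
      demanded by \<open>R_multA\<close>, while \<open>\<mu>\<^sub>D\<close> forms the products of
      \<open>x\<close>, \<open>u\<close> and of \<open>b'\<close>, \<open>b''\<close>.\<close>
    have inner: "tensor_map K D D \<alpha>\<^sub>D \<mu>\<^sub>D (tassoc K D D D
        (insert_middle (pt K A B x b') (sandwich a b'' (tensor_map K A B id p' Y)))) =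
      sandwich (\<alpha>\<^sub>A a) (\<mu>\<^sub>B (pt K B B b' b'')) (m x Y)"
      if x: "x \<in> carrier A" and Y: "Y \<in> carrier D" for x Y
    proof -
      note i = insert_middle(1)[OF pt_closed[OF VA VB x ab(4)]]
      show ?thesis
        by (rule tensor_hom_ext[OF VA VB VDD hom_compose[OF l hom_compose[OF i hom_compose[OF
              sandwich(1)[OF ab(1,6)] tensor_map_hom[OF VA VB VA VB hom_id pq_hom(2)]]]]
              hom_compose[OF s m[OF x]] _ Y])
          (simp add: pts m_pt x tensor_map_pt[OF VA VB VA VB hom_id pq_hom(2)])
    qed
    define n where "n = (\<lambda>X. tensor_map K A B \<mu>\<^sub>A \<beta>\<^sub>B (tassoc_inv K A A B (tensor_map K A D id R
      (tensor_map K A (B \<boxtimes>\<^bsub>K\<^esub> A) id (tensor_map K B A p id) (tassoc K A B A (pt K D A X a''))))))"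
    note pid = tensor_map_hom[OF VB VA VB VA pq_hom(1) hom_id]
    have n: "n \<in> module_hom K D D"
      unfolding n_def
      by (intro hom_compose[OF tensor_map_hom[OF tensor_vectorspace[OF VA VA] VB VA VB A.mu_linear B.beta_linear]]
          hom_compose[OF tassoc_inv(1)[OF VA VA VB]]
          hom_compose[OF tensor_map_hom[OF VA BA VA VD hom_id R_linear]]
          hom_compose[OF tensor_map_hom[OF VA BA VA BA hom_id pid]]
          hom_compose[OF tassoc(1)[OF VA VB VA]] hom_pt_left hom_ident spaces ab)
    have n_pt: "n (pt K A B x y) = m x (R (pt K B A (p y) a''))"
      if "x \<in> carrier A" "y \<in> carrier B" for x y
      unfolding n_def m_def using that ab
      by (simp add: tassoc(2) spaces pt_closed BA pq_closed tensor_map_pt[OF VA BA VA BA hom_id pid]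
          tensor_map_pt[OF VA BA VA VD hom_id R_linear] tensor_map_pt[OF VB VA VB VA pq_hom(1) hom_id])
    have outer: "sandwich (\<alpha>\<^sub>A a) (\<mu>\<^sub>B (pt K B B b' b'')) (n X) = tensor_map K D D \<alpha>\<^sub>D \<mu>\<^sub>D
        (tassoc K D D D (T\<^sub>1 (pt K (D \<boxtimes>\<^bsub>K\<^esub> D) D (sandwich a b' X) (pt K A B a'' b''))))"
      if X: "X \<in> carrier D" for X
      by (rule tensor_hom_ext[OF VA VB VDD hom_compose[OF s n] hom_compose[OF lT
            hom_pt_left[OF VDD VD sandwich(1)[OF ab(1,4)] pt_closed[OF VA VB ab(5,6)]]] _ X])
        (simp add: n_pt T1_pt inner ab sandwich(2) R_closed pq_closed)
    have "R (pt K B A (\<alpha>\<^sub>B b) (\<mu>\<^sub>A (pt K A A a' a''))) = n (R (pt K B A b a'))"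
      using R_multA[of "pt K (B \<boxtimes>\<^bsub>K\<^esub> A) A (pt K B A b a') a''", folded p_def] ab
      by (simp add: n_def pt_closed spaces BA tassoc(2) tensor_map_pt[OF BA VA VD VA R_linear hom_id]
          tensor_map_pt[OF VB tensor_vectorspace[OF VA VA] VB VA B.alpha_linear A.mu_linear])
    then show "T (tensor_map K D D \<alpha>\<^sub>D \<mu>\<^sub>D (tassoc K D D D (pt K (D \<boxtimes>\<^bsub>K\<^esub> D) D
        (pt K D D (pt K A B a b) (pt K A B a' b')) (pt K A B a'' b'')))) =
      tensor_map K D D \<alpha>\<^sub>D \<mu>\<^sub>D (tassoc K D D D (T\<^sub>1 (act12 K D T (pt K (D \<boxtimes>\<^bsub>K\<^esub> D) D
        (pt K D D (pt K A B a b) (pt K A B a' b')) (pt K A B a'' b'')))))"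
      by (simp add: pts outer)
  qed
qed

text \<open>The mirror image: \<open>R_multB\<close> first applies \<open>R\<close> to
  \<open>b'\<close>, \<open>a''\<close>, as \<open>act23\<close> does, and then to \<open>b\<close>
  and \<open>q'\<close> of the new A-component, as \<open>T\<^sub>2\<close> does.\<close>

lemma T_multiplication_left:
  assumes x: "x \<in> carrier ((D \<boxtimes>\<^bsub>K\<^esub> D) \<boxtimes>\<^bsub>K\<^esub> D)"
  shows "T (tensor_map K D D \<mu>\<^sub>D \<beta>\<^sub>D x) = tensor_map K D D \<mu>\<^sub>D \<beta>\<^sub>D (T\<^sub>2 (act23 K D T x))"
proof -
  note VA = spaces(1) and VB = spaces(2) and VD = spaces(3) and VDD = spaces(4)
  note BA = tensor_vectorspace[OF VB VA] and BB = tensor_vectorspace[OF VB VB]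
  note mb = tensor_map_hom[OF VDD VD VD VD muD_hom betaD_hom]
  note mb_pt = tensor_map_pt[OF VDD VD VD VD muD_hom betaD_hom]
  note lT = hom_compose[OF mb T12_hom(2)]
  note am = tensor_map_hom[OF VA BB VA VB A.alpha_linear B.mu_linear]
  show ?thesis
  proof (rule tensor_hom_ext6[OF VA VB VA VB VA VB VDD hom_compose[OF T_hom mb]
        hom_compose[OF lT act23(1)[OF T_hom]] _ x])
    fix a b a' b' a'' b''
    assume ab: "a \<in> carrier A" "b \<in> carrier B" "a' \<in> carrier A" "b' \<in> carrier B"
      "a'' \<in> carrier A" "b'' \<in> carrier B"
    note pts = mb_pt betaD_pt muD_pt T_pt act23(2) T_hom pt_closed spaces closed
      R_closed ab sandwich(2) insert_middle(2) pq_simps pq_closed tassoc_inv(2)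
    \<comment> \<open>\<open>n X\<close> is the right-hand side of \<open>R_multB\<close> with \<open>X\<close> in place of \<open>R (b' \<otimes> a'')\<close>; on a pure tensor
      \<open>X = x \<otimes> y\<close> it is \<open>m y Y\<close>, where \<open>Y\<close> is the value of the second application of \<open>R\<close>.\<close>
    define m where "m = (\<lambda>y Y. tensor_map K A B \<alpha>\<^sub>A \<mu>\<^sub>B (tassoc K A B B (pt K D B Y y)))"
    have m: "m y \<in> module_hom K D D" if "y \<in> carrier B" for y
      unfolding m_def using that
      by (intro hom_compose[OF am] hom_compose[OF tassoc(1)[OF VA VB VB]] hom_pt_left hom_ident spaces)
    have m_pt: "m y (pt K A B u v) = pt K A B (\<alpha>\<^sub>A u) (\<mu>\<^sub>B (pt K B B v y))"
      if "y \<in> carrier B" "u \<in> carrier A" "v \<in> carrier B" for y u v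
      unfolding m_def using that
      by (simp add: tassoc(2) spaces pt_closed
          tensor_map_pt[OF VA BB VA VB A.alpha_linear B.mu_linear])
    note s = sandwich(1)[OF closed(1)[OF ab(1,3)] closed(6)[OF ab(6)]]
    \<comment> \<open>For \<open>Y = u \<otimes> v\<close>, the map \<open>\<beta>\<^sub>D\<close>
      on the last factor sends \<open>q u\<close> to \<open>\<alpha>\<^sub>A u\<close>, as
      \<open>R_multB\<close> requires.\<close>
    have inner: "tensor_map K D D \<mu>\<^sub>D \<beta>\<^sub>D
        (insert_middle (pt K A B a' y) (sandwich a b'' (tensor_map K A B q id Y))) =
      sandwich (\<mu>\<^sub>A (pt K A A a a')) (\<beta>\<^sub>B b'') (m y Y)"
      if y: "y \<in> carrier B" and Y: "Y \<in> carrier D" for y Y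
    proof -
      note i = insert_middle(1)[OF pt_closed[OF VA VB ab(3) y]]
      show ?thesis
        by (rule tensor_hom_ext[OF VA VB VDD hom_compose[OF mb hom_compose[OF i hom_compose[OF
              sandwich(1)[OF ab(1,6)] tensor_map_hom[OF VA VB VA VB pq_hom(3) hom_id]]]]
              hom_compose[OF s m[OF y]] _ Y])
          (simp add: pts m_pt y tensor_map_pt[OF VA VB VA VB pq_hom(3) hom_id])
    qed
    define n where "n = (\<lambda>X. tensor_map K A B \<alpha>\<^sub>A \<mu>\<^sub>B (tassoc K A B B (tensor_map K D B R id
      (tensor_map K (B \<boxtimes>\<^bsub>K\<^esub> A) B (tensor_map K B A id q') id (tassoc_inv K B A B (pt K B D b X))))))"
    note idq = tensor_map_hom[OF VB VA VB VA hom_id pq_hom(4)]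
    have n: "n \<in> module_hom K D D"
      unfolding n_def
      by (intro hom_compose[OF am] hom_compose[OF tassoc(1)[OF VA VB VB]]
          hom_compose[OF tensor_map_hom[OF BA VB VD VB R_linear hom_id]]
          hom_compose[OF tensor_map_hom[OF BA VB BA VB idq hom_id]]
          hom_compose[OF tassoc_inv(1)[OF VB VA VB]] hom_pt_right hom_ident spaces ab)
    have n_pt: "n (pt K A B x y) = m y (R (pt K B A b (q' x)))"
      if "x \<in> carrier A" "y \<in> carrier B" for x y
      unfolding n_def m_def using that ab
      by (simp add: tassoc_inv(2) spaces pt_closed BA pq_closed tensor_map_pt[OF BA VB BA VB idq hom_id]
          tensor_map_pt[OF BA VB VD VB R_linear hom_id] tensor_map_pt[OF VB VA VB VA hom_id pq_hom(4)])
    note r = hom_pt_right[OF VD VDD pt_closed[OF VA VB ab(1,2)] sandwich(1)[OF ab(3,6)]]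
    have outer: "sandwich (\<mu>\<^sub>A (pt K A A a a')) (\<beta>\<^sub>B b'') (n X) = tensor_map K D D \<mu>\<^sub>D \<beta>\<^sub>D
        (T\<^sub>2 (tassoc_inv K D D D (pt K D (D \<boxtimes>\<^bsub>K\<^esub> D) (pt K A B a b) (sandwich a' b'' X))))"
      if X: "X \<in> carrier D" for X
      by (rule tensor_hom_ext[OF VA VB VDD hom_compose[OF s n]
            hom_compose[OF lT hom_compose[OF tassoc_inv(1)[OF VD VD VD] r]] _ X])
        (simp add: n_pt T2_pt inner ab sandwich(2) R_closed pq_closed tassoc_inv(2) spaces pt_closed)
    have "R (pt K B A (\<mu>\<^sub>B (pt K B B b b')) (\<beta>\<^sub>A a'')) = n (R (pt K B A b' a''))"
      using R_multB[of "pt K (B \<boxtimes>\<^bsub>K\<^esub> B) A (pt K B B b b') a''", folded q'_def] ab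
      by (simp add: n_def pt_closed spaces BB tassoc(2) tensor_map_pt[OF VB BA VB VD hom_id R_linear]
          tensor_map_pt[OF BB VA VB VA B.mu_linear A.beta_linear])
    then show "T (tensor_map K D D \<mu>\<^sub>D \<beta>\<^sub>D (pt K (D \<boxtimes>\<^bsub>K\<^esub> D) D
        (pt K D D (pt K A B a b) (pt K A B a' b')) (pt K A B a'' b''))) =
      tensor_map K D D \<mu>\<^sub>D \<beta>\<^sub>D (T\<^sub>2 (act23 K D T (pt K (D \<boxtimes>\<^bsub>K\<^esub> D) D
        (pt K D D (pt K A B a b) (pt K A B a' b')) (pt K A B a'' b''))))"
      by (simp add: pts outer)
  qed
qed

lemma pseudotwistor: "bihom_pseudotwistor K D \<mu>\<^sub>D \<alpha>\<^sub>D \<beta>\<^sub>D T T\<^sub>1 T\<^sub>2"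
proof (intro bihom_pseudotwistor.intro tensor_algebra bihom_pseudotwistor_axioms.intro T_hom T12_hom)
  note aa = tensor_map_hom[OF spaces(3,3,3,3) alphaD_hom alphaD_hom]
    tensor_map_hom[OF spaces(3,3,3,3) betaD_hom betaD_hom]
  note pts = tensor_map_pt[OF spaces(3,3,3,3) alphaD_hom alphaD_hom] alphaD_pt
    tensor_map_pt[OF spaces(3,3,3,3) betaD_hom betaD_hom] betaD_pt T_pt closed pt_closed spaces
    R_closed R_alpha_pt R_beta_pt
  fix x assume x: "x \<in> carrier (D \<boxtimes>\<^bsub>K\<^esub> D)"
  show "(tensor_map K D D \<alpha>\<^sub>D \<alpha>\<^sub>D \<circ> T) x = (T \<circ> tensor_map K D D \<alpha>\<^sub>D \<alpha>\<^sub>D) x"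
    by (rule tensor_hom_ext4[OF spaces(1,2,1,2,4) hom_comp[OF aa(1) T_hom] hom_comp[OF T_hom aa(1)] _ x])
      (simp add: pts tensor_map_sandwich[OF A.alpha_linear B.alpha_linear])
  show "(tensor_map K D D \<beta>\<^sub>D \<beta>\<^sub>D \<circ> T) x = (T \<circ> tensor_map K D D \<beta>\<^sub>D \<beta>\<^sub>D) x"
    by (rule tensor_hom_ext4[OF spaces(1,2,1,2,4) hom_comp[OF aa(2) T_hom] hom_comp[OF T_hom aa(2)] _ x])
      (simp add: pts tensor_map_sandwich[OF A.beta_linear B.beta_linear])
\<comment> \<open>In the compatibility axiom, commutation first makes the arguments of
  \<open>T\<^sub>1\<close> and \<open>T\<^sub>2\<close> identical; \<open>T1_eq_T2\<close> then
  applies to the common argument.\<close>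
qed (auto simp: T_multiplication_right T_multiplication_left act12_act23_commute
    intro!: T1_eq_T2 hom_closed[OF act12(1)[OF T_hom]] hom_closed[OF act23(1)[OF T_hom]])

text \<open>At \<open>R (b \<otimes> a')\<close> the lift on the right is the meaning of aa'_R
  \<otimes> b_R b'. The crossing of components in \<open>sandwich\<close> is what places a'_R to the
  right of \<open>a\<close> and b_R to the left of \<open>b'\<close>.\<close>

lemma muD_sandwich:
  assumes a: "a \<in> carrier A" and b: "b' \<in> carrier B" and x: "x \<in> carrier D"
  shows "\<mu>\<^sub>D (sandwich a b' x) =
    tensor_lift K D (\<lambda>x y. pt K A B (\<mu>\<^sub>A (pt K A A a x)) (\<mu>\<^sub>B (pt K B B y b'))) x"
proof -
  have bil: "bilinear_map K A B D (\<lambda>x y. pt K A B (\<mu>\<^sub>A (pt K A A a x)) (\<mu>\<^sub>B (pt K B B y b')))"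
    using a b by (intro bilinear_mapI hom_pt_left hom_pt_right hom_compose[OF A.mu_linear]
        hom_compose[OF B.mu_linear] hom_ident closed spaces)
  show ?thesis
    by (rule tensor_hom_ext[OF spaces(1,2,3) hom_compose[OF muD_hom sandwich(1)[OF a b]]
          tensor_lift_hom[OF spaces(1,2,3) bil] _ x])
      (simp add: sandwich(2) a b muD_pt tensor_lift_pt[OF spaces(1,2,3) bil])
qed

end

theorem proposition7p6:
  fixes K :: "('k, 'm) ring_scheme"
    and A :: "('k, 'a, 'n1) module_scheme"
    and B :: "('k, 'b, 'n2) module_scheme"
    and R :: "('b \<times> 'a \<Rightarrow> 'k) set \<Rightarrow> ('a \<times> 'b \<Rightarrow> 'k) set"
  assumes A: "bihom_assoc_algebra K A \<mu>\<^sub>A \<alpha>\<^sub>A \<beta>\<^sub>A"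
    and B: "bihom_assoc_algebra K B \<mu>\<^sub>B \<alpha>\<^sub>B \<beta>\<^sub>B"
    and bij: "bij_betw \<alpha>\<^sub>A (carrier A) (carrier A)" "bij_betw \<beta>\<^sub>A (carrier A) (carrier A)"
      "bij_betw \<alpha>\<^sub>B (carrier B) (carrier B)" "bij_betw \<beta>\<^sub>B (carrier B) (carrier B)"
    and R: "bihom_twisting_map K A \<mu>\<^sub>A \<alpha>\<^sub>A \<beta>\<^sub>A B \<mu>\<^sub>B \<alpha>\<^sub>B \<beta>\<^sub>B R"
    and D: "D = A \<boxtimes>\<^bsub>K\<^esub> B"
    and muD: "\<mu>\<^sub>D = tensor_mult K A \<mu>\<^sub>A B \<mu>\<^sub>B"
    and alphaD: "\<alpha>\<^sub>D = tensor_map K A B \<alpha>\<^sub>A \<alpha>\<^sub>B"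
    and betaD: "\<beta>\<^sub>D = tensor_map K A B \<beta>\<^sub>A \<beta>\<^sub>B"
    and T: "T = twistor_of K A B R"
    and T1: "T\<^sub>1 =
      tensor_map K (D \<boxtimes>\<^bsub>K\<^esub> D) D
        (tensor_map K D D
          (tensor_map K A B id (inv_into (carrier B) \<alpha>\<^sub>B \<circ> \<beta>\<^sub>B)) (tensor_map K A B id id))
        (tensor_map K A B id id)
      \<circ> act13 K D T
      \<circ> tensor_map K (D \<boxtimes>\<^bsub>K\<^esub> D) D
        (tensor_map K D D
          (tensor_map K A B id (\<alpha>\<^sub>B \<circ> inv_into (carrier B) \<beta>\<^sub>B)) (tensor_map K A B id id))
        (tensor_map K A B id id)"
    and T2: "T\<^sub>2 =
      tensor_map K (D \<boxtimes>\<^bsub>K\<^esub> D) D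
        (tensor_map K D D (tensor_map K A B id id) (tensor_map K A B id id))
        (tensor_map K A B (\<alpha>\<^sub>A \<circ> inv_into (carrier A) \<beta>\<^sub>A) id)
      \<circ> act13 K D T
      \<circ> tensor_map K (D \<boxtimes>\<^bsub>K\<^esub> D) D
        (tensor_map K D D (tensor_map K A B id id) (tensor_map K A B id id))
        (tensor_map K A B (inv_into (carrier A) \<alpha>\<^sub>A \<circ> \<beta>\<^sub>A) id)"
  shows "T \<in> module_hom K (D \<boxtimes>\<^bsub>K\<^esub> D) (D \<boxtimes>\<^bsub>K\<^esub> D)
    \<and> (\<forall>a\<in>carrier A. \<forall>b\<in>carrier B. \<forall>a'\<in>carrier A. \<forall>b'\<in>carrier B.
        T (pt K D D (pt K A B a b) (pt K A B a' b')) =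
        tensor_lift K (D \<boxtimes>\<^bsub>K\<^esub> D) (\<lambda>x y. pt K D D (pt K A B a y) (pt K A B x b')) (R (pt K B A b a')))
    \<and> bihom_pseudotwistor K D \<mu>\<^sub>D \<alpha>\<^sub>D \<beta>\<^sub>D T T\<^sub>1 T\<^sub>2
    \<and> bihom_assoc_algebra K D (\<mu>\<^sub>D \<circ> T) \<alpha>\<^sub>D \<beta>\<^sub>D
    \<and> (\<forall>a\<in>carrier A. \<forall>b\<in>carrier B. \<forall>a'\<in>carrier A. \<forall>b'\<in>carrier B.
        (\<mu>\<^sub>D \<circ> T) (pt K D D (pt K A B a b) (pt K A B a' b')) =
        tensor_lift K D (\<lambda>x y. pt K A B (\<mu>\<^sub>A (pt K A A a x)) (\<mu>\<^sub>B (pt K B B y b'))) (R (pt K B A b a')))"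
proof -
  interpret P: bihom_twisting_map K A \<mu>\<^sub>A \<alpha>\<^sub>A \<beta>\<^sub>A B \<mu>\<^sub>B \<alpha>\<^sub>B \<beta>\<^sub>B R by (fact R)
  have T': "T = P.T" by (simp only: T P.T_def)
  \<comment> \<open>The companion of the theorem is literally
    \<open>outer p' id \<circ> act13 K D T \<circ> outer p id\<close>, so unfolding
    suffices.\<close>
  have T1': "T\<^sub>1 = P.T\<^sub>1" by (simp only: T1 T' D P.T\<^sub>1_def P.p_def P.p'_def)
  have T2': "T\<^sub>2 = P.T\<^sub>2" by (simp only: T2 T' D P.T\<^sub>2_def P.q_def P.q'_def)
  show ?thesis
    unfolding T1' T2' unfolding T' D muD alphaD betaD
    by (intro conjI ballI P.T_hom P.T_pt P.pseudotwistor
        bihom_pseudotwistor.twisted_algebra[OF P.pseudotwistor])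
      (simp_all add: P.T_pt P.muD_sandwich P.R_closed)
qed

end
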